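(* Suppose that Lebesgue's differentiation theorem holds for $(\mathcal P,\mu)$, i.e., for every $f\in L^1_{\mathrm{loc}}(\mathcal P)$ one has $\lim_{r\to0}\frac{1}{\mu(B(x,r))}\int_{B(x,r)}f\,d\mu=f(x)$ for $\mu$-a.e. $x\in\mathcal P$. Let $\varphi\in\mathcal C([0,\infty])$ be a strictly increasing non-negative function (continuous on the compactified interval $[0,\infty]$, possibly with $\varphi(\infty)=\infty$) with $\varphi(0)=0$ such that $\varphi\circ|f|\in L^1_{\mathrm{loc}}(\mathcal P)$ whenever $f\in X$. Suppose further that one of the following two conditions is fulfilled: (a) $\varphi$ is subadditive, i.e., $\varphi(x+y)\le\varphi(x)+\varphi(y)$ for any $x,y\in[0,\infty]$; (b) $\varphi$ supports a Minkowski-type inequality, i.e., the inequality $$\varphi^{-1}\Bigl(\frac1{\mu(E)}\int_E\varphi\circ(f+h)\,d\mu\Bigr)\le\varphi^{-1}\Bigl(\frac1{\mu(E)}\int_E\varphi\circ f\,d\mu\Bigr)+\varphi^{-1}\Bigl(\frac1{\mu(E)}\int_E\varphi\circ h\,d\mu\Bigr)$$ holds for any measurable $E\subset\mathcal P$ of finite positive measure and any non-negative measurable functions $f$ and $h$. Let $u\in DX$ and define $$g_1(x)=\inf_g\limsup_{r\to0^+}\varphi^{-1}\Bigl(\frac1{\mu(B(x,r))}\int_{B(x,r)}\varphi\circ g\,d\mu\Bigr),\quad x\in\mathcal P,$$ where the infimum is taken over all $X$-weak upper gradients $g\in X$ of $u$. Let further $g_2$ be defined similarly, but taking the infimum only over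 all upper gradients $g\in X$ of $u$. Then $g_1=g_2=g_u$ $\mu$-a.e., where $g_u$ is the minimal $X$-weak upper gradient of $u$, and thus both $g_1$ and $g_2$ are minimal $X$-weak upper gradients of $u$.
   Context: Setting: $\mathcal P=(\mathcal P,d,\mu)$ is a metric space equipped with a $\sigma$-finite Borel regular measure $\mu$ (all Borel sets are $\mu$-measurable, and each $\mu$-measurable set $A$ is contained in a Borel set $D$ with $\mu(D)=\mu(A)$) such that every ball has finite positive measure. $B(x,r)$ is the open ball. $\mathcal M(\mathcal P,\mu)$ is the set of all extended real-valued $\mu$-measurable functions on $\mathcal P$. $L^1_{\mathrm{loc}}(\mathcal P)$ is the set of measurable functions that are integrable on some ball around each point of $\mathcal P$. $X$ is a quasi-Banach function lattice: there is a functional $\|\cdot\|_X:\mathcal M(\mathcal P,\mu)\to[0,\infty]$ with (P0) $X=\{u\in\mathcal M(\mathcal P,\mu):\|u\|_X<\infty\}$; (P1) $\|u\|_X=0$ iff $u=0$ a.e., $\|au\|_X=|a|\|u\|_X$ for $a\in\mathbb R$, and there is a constant $c\ge1$ (modulus of concavity) with $\|u+v\|_X\le c(\|u\|_X+\|v\|_X)$ for all $u,v$; (P2) if $|u|\le|v|$ a.e. then $\|u\|_X\le\|v\|_X$; (RF) if $u_n\ge0$ a.e. for all $n\in\mathbb N=\{1,2,\dots\}$, then $\|\sum_{n=1}^\infty u_n\|_X\le\sum_{n=1}^\infty c^n\|u_n\|_X$ (pointwise a.e. sum). The quasi-norm is assumed continuous: $\|u_n-u\|_X\to0$ implies $\|u_n\|_X\to\|u\|_X$.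 Elements of $X$ are functions defined everywhere on $\mathcal P$ (not equivalence classes); they are finite a.e. A curve is a rectifiable non-constant continuous map from a compact interval into $\mathcal P$, always parameterized by arc length, $\gamma:[0,l_\gamma]\to\mathcal P$; $ds$ is arc length. The $X$-modulus of a family $\Gamma$ of curves is $\mathrm{Mod}_X(\Gamma)=\inf\|\rho\|_X$ over all Borel $\rho:\mathcal P\to[0,\infty]$ with $\int_\gamma\rho\,ds\ge1$ for all $\gamma\in\Gamma$. A property holds for $\mathrm{Mod}_X$-a.e. curve if the exceptional family has zero $X$-modulus. For a non-negative measurable $g$, $\int_\gamma g\,ds$ is well defined in $[0,\infty]$ for $\mathrm{Mod}_X$-a.e. $\gamma$. A Borel function $g:\mathcal P\to[0,\infty]$ is an upper gradient of $u:\mathcal P\to\mathbb R\cup\{\pm\infty\}$ if $|u(\gamma(0))-u(\gamma(l_\gamma))|\le\int_\gamma g\,ds$ for all curves $\gamma$, with the convention $|(\pm\infty)-(\pm\infty)|=\infty$. A non-negative (possibly $\infty$-valued) $\mu$-measurable $g$ is an $X$-weak upper gradient of $u$ if this inequality holds for $\mathrm{Mod}_X$-a.e. curve. The Dirichlet space $DX$ is the set of measurable (extended real-valued) functions having an upper gradient in $X$. For $u\in DX$, a minimal $X$-weak upper gradient of $u$ is an $X$-weak upper gradient $g_u\in X$ of $u$ such that $g_u\le g$ a.e. for all $X$-weak upper gradients $g\in X$ of $u$; it exists and is unique up to sets of measure zero. *)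

theory Defs
  imports "HOL-Analysis.Analysis"
begin

section \<open>The underlying metric measure space\<close>

text \<open>
  The sigma-algebra of \<open>M\<close> consists of the \<open>\<mu>\<close>-measurable sets. As usual for Borel regular measures
  (which are outer measures, with measurability in the sense of Caratheodory) it contains all
  subsets of null sets, hence the completeness requirement.
\<close>

locale borel_regular_space = sigma_finite_measure M + complete_measure M
  for M :: "'a::metric_space measure" +
  assumes space_M: "space M = UNIV"
    and borel_sets: "sets borel \<subseteq> sets M"
    and borel_regular:
      "A \<in> sets M \<Longrightarrow> \<exists>D\<in>sets borel. A \<subseteq> D \<and> emeasure M D = emeasure M A"
    and ball_finite: "0 < r \<Longrightarrow> emeasure M (ball x r) < \<infinity>"
    and ball_pos: "0 < r \<Longrightarrow> 0 < emeasure M (ball x r)"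


section \<open>Quasi-Banach function lattices\<close>

definition fun_space :: "'a measure \<Rightarrow> (('a \<Rightarrow> ereal) \<Rightarrow> ennreal) \<Rightarrow> ('a \<Rightarrow> ereal) set" where
  "fun_space M N = {u \<in> borel_measurable M. N u < \<infinity>}"

text \<open>
  Only the values of the functional \<open>N\<close> on measurable functions matter. In \<open>triangle\<close> the sum uses
  the library's convention \<open>\<infinity> + (-\<infinity>) = \<infinity>\<close>; this is immaterial, as functions of finite quasi-norm
  are finite almost everywhere and otherwise the right-hand side is infinite. In \<open>riesz_fischer\<close>
  the sequence is indexed from 0, so that the weight of \<open>u n\<close> is \<open>c ^ Suc n\<close>.
\<close>

locale quasi_banach_function_lattice =
  fixes M :: "'a measure" and N :: "('a \<Rightarrow> ereal) \<Rightarrow> ennreal" and c :: real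
  assumes modulus_ge_1: "1 \<le> c"
    and zero_iff: "u \<in> borel_measurable M \<Longrightarrow> N u = 0 \<longleftrightarrow> (AE x in M. u x = 0)"
    and scale: "u \<in> borel_measurable M \<Longrightarrow> N (\<lambda>x. ereal a * u x) = ennreal \<bar>a\<bar> * N u"
    and triangle: "u \<in> borel_measurable M \<Longrightarrow> v \<in> borel_measurable M \<Longrightarrow>
      N (\<lambda>x. u x + v x) \<le> ennreal c * (N u + N v)"
    and lattice: "u \<in> borel_measurable M \<Longrightarrow> v \<in> borel_measurable M \<Longrightarrow>
      AE x in M. \<bar>u x\<bar> \<le> \<bar>v x\<bar> \<Longrightarrow> N u \<le> N v"
    and riesz_fischer: "(\<And>n. w n \<in> borel_measurable M) \<Longrightarrow> (\<And>n. AE x in M. 0 \<le> w n x) \<Longrightarrow>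
      N (\<lambda>x. \<Sum>n. w n x) \<le> (\<Sum>n. ennreal c ^ Suc n * N (w n))"
    and continuous: "(\<And>n. w n \<in> fun_space M N) \<Longrightarrow> u \<in> fun_space M N \<Longrightarrow>
      (\<lambda>n. N (\<lambda>x. w n x - u x)) \<longlonglongrightarrow> 0 \<Longrightarrow> (\<lambda>n. N (w n)) \<longlonglongrightarrow> N u"

text \<open>Non-negative functions are represented as functions into \<^typ>\<open>ennreal\<close>.\<close>

definition nonneg_fun_space :: "'a measure \<Rightarrow> (('a \<Rightarrow> ereal) \<Rightarrow> ennreal) \<Rightarrow> ('a \<Rightarrow> ennreal) set" where
  "nonneg_fun_space M N = {g. (\<lambda>x. enn2ereal (g x)) \<in> fun_space M N}"


section \<open>Curves, line integrals and the modulus\<close>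

definition curve_length :: "(real \<Rightarrow> 'a::metric_space) \<Rightarrow> real \<Rightarrow> real \<Rightarrow> ennreal" where
  "curve_length \<gamma> a b =
    (SUP ts\<in>{ts. sorted ts \<and> set ts \<subseteq> {a..b}}.
       \<Sum>i<length ts - 1. ennreal (dist (\<gamma> (ts ! i)) (\<gamma> (ts ! Suc i))))"

text \<open>
  A non-constant rectifiable curve, parameterized by arc length, is a pair \<open>(l, \<gamma>)\<close> of its (finite,
  positive) length \<open>l\<close> and a map \<open>\<gamma>\<close> of which only the restriction to \<open>{0..l}\<close> matters.
\<close>

definition curves :: "(real \<times> (real \<Rightarrow> 'a::metric_space)) set" where
  "curves = {(l, \<gamma>). 0 < l \<and> continuous_on {0..l} \<gamma> \<and>
                     (\<forall>t\<in>{0..l}. curve_length \<gamma> 0 t = ennreal t)}"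

definition line_integral :: "real \<times> (real \<Rightarrow> 'a) \<Rightarrow> ('a \<Rightarrow> ennreal) \<Rightarrow> ennreal" where
  "line_integral = (\<lambda>(l, \<gamma>) g. \<integral>\<^sup>+t\<in>{0..l}. g (\<gamma> t) \<partial>lebesgue)"

definition line_measurable :: "real \<times> (real \<Rightarrow> 'a) \<Rightarrow> ('a \<Rightarrow> ennreal) \<Rightarrow> bool" where
  "line_measurable = (\<lambda>(l, \<gamma>) g. (\<lambda>t. g (\<gamma> t)) \<in> borel_measurable (lebesgue_on {0..l}))"

definition curve_modulus ::
    "(('a::metric_space \<Rightarrow> ereal) \<Rightarrow> ennreal) \<Rightarrow> (real \<times> (real \<Rightarrow> 'a)) set \<Rightarrow> ennreal" where
  "curve_modulus N \<Gamma> =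
    (INF \<rho>\<in>{\<rho> \<in> borel_measurable borel. \<forall>\<gamma>\<in>\<Gamma>. 1 \<le> line_integral \<gamma> \<rho>}. N (\<lambda>x. enn2ereal (\<rho> x)))"

definition almost_every_curve ::
    "(('a::metric_space \<Rightarrow> ereal) \<Rightarrow> ennreal) \<Rightarrow> (real \<times> (real \<Rightarrow> 'a) \<Rightarrow> bool) \<Rightarrow> bool" where
  "almost_every_curve N P \<longleftrightarrow> curve_modulus N {\<gamma> \<in> curves. \<not> P \<gamma>} = 0"


section \<open>Upper gradients\<close>

text \<open>
  Subtraction on \<^typ>\<open>ereal\<close> satisfies \<open>\<bar>\<infinity> - \<infinity>\<bar> = \<bar>(-\<infinity>) - (-\<infinity>)\<bar> = \<infinity>\<close>, which is the convention
  needed here.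
\<close>

definition end_gap :: "('a \<Rightarrow> ereal) \<Rightarrow> real \<times> (real \<Rightarrow> 'a) \<Rightarrow> ennreal" where
  "end_gap u = (\<lambda>(l, \<gamma>). e2ennreal \<bar>u (\<gamma> 0) - u (\<gamma> l)\<bar>)"

definition upper_gradient :: "('a::metric_space \<Rightarrow> ereal) \<Rightarrow> ('a \<Rightarrow> ennreal) \<Rightarrow> bool" where
  "upper_gradient u g \<longleftrightarrow>
    g \<in> borel_measurable borel \<and> (\<forall>\<gamma>\<in>curves. end_gap u \<gamma> \<le> line_integral \<gamma> g)"

text \<open>
  For a \<open>\<mu>\<close>-measurable \<open>g\<close> the line integral is meaningful on almost every curve only, which is made
  explicit by \<^const>\<open>line_measurable\<close>.
\<close>

definition weak_upper_gradient ::
    "'a::metric_space measure \<Rightarrow> (('a \<Rightarrow> ereal) \<Rightarrow> ennreal) \<Rightarrow> ('a \<Rightarrow> ereal) \<Rightarrow> ('a \<Rightarrow> ennreal) \<Rightarrow> bool"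
  where
  "weak_upper_gradient M N u g \<longleftrightarrow> g \<in> borel_measurable M \<and>
    almost_every_curve N (\<lambda>\<gamma>. line_measurable \<gamma> g \<and> end_gap u \<gamma> \<le> line_integral \<gamma> g)"

definition dirichlet_space ::
    "'a::metric_space measure \<Rightarrow> (('a \<Rightarrow> ereal) \<Rightarrow> ennreal) \<Rightarrow> ('a \<Rightarrow> ereal) set" where
  "dirichlet_space M N =
    {u \<in> borel_measurable M. \<exists>g\<in>nonneg_fun_space M N. upper_gradient u g}"

definition minimal_weak_upper_gradient ::
    "'a::metric_space measure \<Rightarrow> (('a \<Rightarrow> ereal) \<Rightarrow> ennreal) \<Rightarrow> ('a \<Rightarrow> ereal) \<Rightarrow> ('a \<Rightarrow> ennreal) \<Rightarrow> bool"
  where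
  "minimal_weak_upper_gradient M N u g \<longleftrightarrow>
    weak_upper_gradient M N u g \<and> g \<in> nonneg_fun_space M N \<and>
    (\<forall>h\<in>nonneg_fun_space M N. weak_upper_gradient M N u h \<longrightarrow> (AE x in M. g x \<le> h x))"


section \<open>Local integrability, averages and the functions \<open>g\<^sub>1\<close>, \<open>g\<^sub>2\<close>\<close>

definition locally_integrable :: "'a::metric_space measure \<Rightarrow> ('a \<Rightarrow> ereal) set" where
  "locally_integrable M = {f \<in> borel_measurable M.
     \<forall>x. \<exists>r>0. (\<integral>\<^sup>+y\<in>ball x r. e2ennreal \<bar>f y\<bar> \<partial>M) < \<infinity>}"

text \<open>
  A locally integrable \<open>f\<close> is finite almost everywhere on all small balls around \<open>x\<close>, so that
  applying \<^const>\<open>real_of_ereal\<close> does not change its averages there.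
\<close>

definition lebesgue_differentiation :: "'a::metric_space measure \<Rightarrow> bool" where
  "lebesgue_differentiation M \<longleftrightarrow> (\<forall>f\<in>locally_integrable M. AE x in M.
     ((\<lambda>r. ereal ((LINT y:ball x r|M. real_of_ereal (f y)) / measure M (ball x r)))
        \<longlongrightarrow> f x) (at_right 0))"

definition nn_average :: "'a measure \<Rightarrow> 'a set \<Rightarrow> ('a \<Rightarrow> ennreal) \<Rightarrow> ennreal" where
  "nn_average M E f = (\<integral>\<^sup>+x\<in>E. f x \<partial>M) / emeasure M E"

text \<open>
  For a strictly increasing continuous \<open>\<phi>\<close> on \<open>[0,\<infinity>]\<close> with \<open>\<phi> 0 = 0\<close>, the averages of \<open>\<phi> \<circ> f\<close> lie in
  \<open>[0, \<phi> \<infinity>] = range \<phi>\<close>, so that \<^term>\<open>inv \<phi>\<close> is only applied in the range of \<open>\<phi>\<close>.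
\<close>

definition phi_mean ::
    "'a measure \<Rightarrow> (ennreal \<Rightarrow> ennreal) \<Rightarrow> 'a set \<Rightarrow> ('a \<Rightarrow> ennreal) \<Rightarrow> ennreal" where
  "phi_mean M \<phi> E f = inv \<phi> (nn_average M E (\<lambda>x. \<phi> (f x)))"

definition phi_subadditive :: "(ennreal \<Rightarrow> ennreal) \<Rightarrow> bool" where
  "phi_subadditive \<phi> \<longleftrightarrow> (\<forall>x y. \<phi> (x + y) \<le> \<phi> x + \<phi> y)"

definition minkowski_type :: "'a measure \<Rightarrow> (ennreal \<Rightarrow> ennreal) \<Rightarrow> bool" where
  "minkowski_type M \<phi> \<longleftrightarrow>
    (\<forall>E\<in>sets M. \<forall>f\<in>borel_measurable M. \<forall>h\<in>borel_measurable M.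
       0 < emeasure M E \<and> emeasure M E < \<infinity> \<longrightarrow>
       phi_mean M \<phi> E (\<lambda>x. f x + h x) \<le> phi_mean M \<phi> E f + phi_mean M \<phi> E h)"

definition upper_phi_density ::
    "'a::metric_space measure \<Rightarrow> (ennreal \<Rightarrow> ennreal) \<Rightarrow> ('a \<Rightarrow> ennreal) \<Rightarrow> 'a \<Rightarrow> ennreal" where
  "upper_phi_density M \<phi> g x = Limsup (at_right 0) (\<lambda>r. phi_mean M \<phi> (ball x r) g)"

definition g1_fun :: "'a::metric_space measure \<Rightarrow> (('a \<Rightarrow> ereal) \<Rightarrow> ennreal) \<Rightarrow>
    (ennreal \<Rightarrow> ennreal) \<Rightarrow> ('a \<Rightarrow> ereal) \<Rightarrow> 'a \<Rightarrow> ennreal" where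
  "g1_fun M N \<phi> u x =
    (INF g\<in>{g \<in> nonneg_fun_space M N. weak_upper_gradient M N u g}. upper_phi_density M \<phi> g x)"

definition g2_fun :: "'a::metric_space measure \<Rightarrow> (('a \<Rightarrow> ereal) \<Rightarrow> ennreal) \<Rightarrow>
    (ennreal \<Rightarrow> ennreal) \<Rightarrow> ('a \<Rightarrow> ereal) \<Rightarrow> 'a \<Rightarrow> ennreal" where
  "g2_fun M N \<phi> u x =
    (INF g\<in>{g \<in> nonneg_fun_space M N. upper_gradient u g}. upper_phi_density M \<phi> g x)"

end

theory Submission
  imports Defs
begin

text \<open>
  The lower bound \<open>g\<^sub>u \<le> g\<^sub>1\<close> is a comparison of averages made before any infimum is taken. If \<open>g \<in> X\<close> is a
  weak upper gradient, then \<open>g\<^sub>u \<le> g\<close> almost everywhere, hence the \<open>\<phi>\<close>-mean of \<open>g\<^sub>u\<close> over any ball is at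
  most that of \<open>g\<close>, and so the upper \<open>\<phi>\<close>-density of \<open>g\<^sub>u\<close> is at most that of \<open>g\<close> at \<^emph>\<open>every\<close> point. Therefore
  the infimum over the uncountably many \<open>g\<close> creates no problem with null sets, and \<open>g\<^sub>1\<close> is at least
  the upper \<open>\<phi>\<close>-density of \<open>g\<^sub>u\<close>. By Lebesgue's theorem for \<open>\<phi> \<circ> g\<^sub>u\<close> and continuity of \<open>inv \<phi>\<close>, the latter is
  \<open>g\<^sub>u\<close> almost everywhere.

  For \<open>g\<^sub>2 \<le> g\<^sub>u\<close> countably many upper gradients suffice: the exceptional curves of \<open>g\<^sub>u\<close> are among those with
  \<open>\<integral>\<^sub>\<gamma> \<rho> ds = \<infinity>\<close> for some \<open>\<rho> \<in> X\<close>, so if \<open>g'\<close> is a Borel majorant of \<open>g\<^sub>u\<close> equal to it almost everywhere,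
  then every \<open>g' + \<rho> / k\<close> is an upper gradient. Each has its own value as upper \<open>\<phi>\<close>-density almost everywhere,
  and these values tend to \<open>g\<^sub>u\<close> because \<open>\<rho>\<close> is finite almost everywhere. As upper gradients are weak
  upper gradients, \<open>g\<^sub>1 \<le> g\<^sub>2\<close>, which closes the chain (\<open>g1_g2_eq_minimal\<close>).

  That \<open>g\<^sub>1\<close> and \<open>g\<^sub>2\<close> are themselves minimal requires a minimal weak upper gradient to exist
  (\<open>ex_minimal_weak_upper_gradient\<close>) and weak upper gradients to be stable under changes on null sets
  (\<open>weak_upper_gradient_cong_AE\<close>). Existence is an essential infimum argument, and the family of weak
  upper gradients in \<open>X\<close> is stable under the two operations that it uses. Under minima
  (\<open>weak_upper_gradient_min\<close>): almost every curve has only good subcurves, so both functions bound the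
  oscillation of \<open>u\<close> over all subintervals, and such bounds can be spliced along an arbitrary Borel set
  of parameters (\<open>splice_gap_bounds\<close>). Under decreasing limits (\<open>weak_upper_gradient_INF\<close>): the line
  integrals converge on almost every curve by monotone convergence.
\<close>

section \<open>Subcurves\<close>

definition polygon_length :: "(real \<Rightarrow> 'a::metric_space) \<Rightarrow> real list \<Rightarrow> ennreal" where
  "polygon_length \<gamma> ts = (\<Sum>i<length ts - 1. ennreal (dist (\<gamma> (ts ! i)) (\<gamma> (ts ! Suc i))))"

lemma polygon_length_simps [simp]:
  "polygon_length \<gamma> [] = 0"
  "polygon_length \<gamma> [s] = 0"
  "polygon_length \<gamma> (s # t # ts) = ennreal (dist (\<gamma> s) (\<gamma> t)) + polygon_length \<gamma> (t # ts)"
  by (simp_all add: polygon_length_def sum.lessThan_Suc_shift del: sum.lessThan_Suc)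

lemma polygon_length_append_ge:
  "polygon_length \<gamma> xs + polygon_length \<gamma> ys \<le> polygon_length \<gamma> (xs @ ys)"
proof (induction xs rule: induct_list012)
  case (2 x)
  then show ?case by (cases ys) auto
qed (auto simp: add.assoc)

text \<open>
  Inserting the point \<open>s\<close> between the two parts of a polygon cannot shorten it, by the triangle
  inequality.
\<close>

lemma polygon_length_append_le:
  "polygon_length \<gamma> (xs @ ys) \<le> polygon_length \<gamma> (xs @ [s]) + polygon_length \<gamma> (s # ys)"
proof (induction xs rule: induct_list012)
  case 1
  then show ?case by (cases ys) auto
next
  case (2 x)
  have "ennreal (dist (\<gamma> x) (\<gamma> y)) \<le> ennreal (dist (\<gamma> x) (\<gamma> s)) + ennreal (dist (\<gamma> s) (\<gamma> y))" for y
    by (metis dist_triangle ennreal_leI ennreal_plus zero_le_dist)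
  then show ?case by (cases ys) (auto simp flip: add.assoc intro: add_right_mono)
qed (auto simp: add.assoc)

lemma curve_length_eq:
  "curve_length \<gamma> a b = (SUP ts\<in>{ts. sorted ts \<and> set ts \<subseteq> {a..b}}. polygon_length \<gamma> ts)"
  by (simp add: curve_length_def polygon_length_def)

text \<open>
  Partitions of the two halves concatenate to one of the whole interval. Conversely, a partition of the
  whole interval is cut at \<open>s\<close>, and \<open>s\<close> is added to both pieces.
\<close>

lemma curve_length_add:
  assumes "a \<le> s" "s \<le> b"
  shows "curve_length \<gamma> a b = curve_length \<gamma> a s + curve_length \<gamma> s b"
proof (rule antisym)
  show "curve_length \<gamma> a b \<le> curve_length \<gamma> a s + curve_length \<gamma> s b"
    unfolding curve_length_eq[of \<gamma> a b]
  proof (safe intro!: SUP_least)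
    fix ts assume ts: "sorted ts" "set ts \<subseteq> {a..b}"
    define xs ys where "xs = takeWhile (\<lambda>t. t \<le> s) ts" and "ys = dropWhile (\<lambda>t. t \<le> s) ts"
    have eq: "ts = xs @ ys" by (simp add: xs_def ys_def)
    have xs: "t \<le> s" if "t \<in> set xs" for t
      using that set_takeWhileD unfolding xs_def by fastforce
    have ys: "s \<le> t" if "t \<in> set ys" for t
    proof (cases ys)
      case (Cons y zs)
      then have "\<not> y \<le> s" using hd_dropWhile[of "\<lambda>t. t \<le> s" ts] unfolding ys_def by simp
      moreover have "sorted ys" using ts eq sorted_append by metis
      ultimately show ?thesis using that Cons by fastforce
    qed (use that in auto)
    have "polygon_length \<gamma> (xs @ [s]) \<le> curve_length \<gamma> a s"
      unfolding curve_length_eq using ts eq xs assms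
      by (intro SUP_upper) (auto simp: sorted_append)
    moreover have "polygon_length \<gamma> (s # ys) \<le> curve_length \<gamma> s b"
      unfolding curve_length_eq using ts eq ys assms
      by (intro SUP_upper) (auto simp: sorted_append)
    ultimately show "polygon_length \<gamma> ts \<le> curve_length \<gamma> a s + curve_length \<gamma> s b"
      using polygon_length_append_le[of \<gamma> xs ys s] eq by (meson add_mono order_trans)
  qed
next
  have ne: "\<And>a b::real. {ts. sorted ts \<and> set ts \<subseteq> {a..b}} \<noteq> {}"
    by (auto intro!: exI[of _ "[]"])
  have "polygon_length \<gamma> xs + polygon_length \<gamma> ys \<le> curve_length \<gamma> a b"
    if "sorted xs" "set xs \<subseteq> {a..s}" "sorted ys" "set ys \<subseteq> {s..b}" for xs ys
  proof -
    have "sorted (xs @ ys)" "set (xs @ ys) \<subseteq> {a..b}"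
      using that assms by (force simp: sorted_append)+
    then have "polygon_length \<gamma> (xs @ ys) \<le> curve_length \<gamma> a b"
      unfolding curve_length_eq by (intro SUP_upper) simp
    then show ?thesis using polygon_length_append_ge order_trans by blast
  qed
  then show "curve_length \<gamma> a s + curve_length \<gamma> s b \<le> curve_length \<gamma> a b"
    unfolding curve_length_eq[of \<gamma> a s] curve_length_eq[of \<gamma> s b]
    by (subst ennreal_SUP_add_left[OF ne, symmetric], intro SUP_least,
        subst ennreal_SUP_add_right[OF ne], intro SUP_least) auto
qed

lemma curve_length_shift: "curve_length (\<lambda>t. \<gamma> (a + t)) 0 s = curve_length \<gamma> a (a + s)"
proof -
  have poly: "polygon_length (\<lambda>t. \<gamma> (a + t)) ts = polygon_length \<gamma> (map ((+) a) ts)" for ts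
    by (auto simp: polygon_length_def intro!: sum.cong)
  have mono: "sorted (map ((+) a) ts) \<longleftrightarrow> sorted ts" for a :: real and ts
    by (simp add: sorted_map)
  have "map ((+) a) ` {ts. sorted ts \<and> set ts \<subseteq> {0..s}} = {ts. sorted ts \<and> set ts \<subseteq> {a..a + s}}"
  proof (safe, goal_cases)
    case (3 ts)
    then show ?case
      by (intro image_eqI[of _ _ "map ((+) (- a)) ts"]) (fastforce simp: mono o_def)+
  qed (auto simp: mono)
  then show ?thesis
    unfolding curve_length_eq poly by (metis image_image)
qed

text \<open>
  The parameter is shifted to start at 0, so that a subcurve is again parameterized by arc length.
\<close>

definition subcurve :: "real \<Rightarrow> real \<Rightarrow> real \<times> (real \<Rightarrow> 'a) \<Rightarrow> real \<times> (real \<Rightarrow> 'a)" where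
  "subcurve a b = (\<lambda>(l, \<gamma>). (b - a, \<lambda>t. \<gamma> (a + t)))"

lemma subcurve_full [simp]: "subcurve 0 l (l, \<gamma>) = (l, \<gamma>)"
  by (simp add: subcurve_def)

lemma end_gap_subcurve: "end_gap u (subcurve a b (l, \<gamma>)) = e2ennreal \<bar>u (\<gamma> a) - u (\<gamma> b)\<bar>"
  by (simp add: subcurve_def end_gap_def)

lemma subcurve_in_curves:
  assumes "(l, \<gamma>) \<in> curves" "0 \<le> a" "a < b" "b \<le> l"
  shows "subcurve a b (l, \<gamma>) \<in> curves"
proof -
  have cont: "continuous_on {0..l} \<gamma>" and len: "\<And>t. t \<in> {0..l} \<Longrightarrow> curve_length \<gamma> 0 t = ennreal t"
    using assms by (auto simp: curves_def)
  have "curve_length (\<lambda>t. \<gamma> (a + t)) 0 t = ennreal t" if t: "t \<in> {0..b - a}" for t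
  proof -
    have "ennreal a + curve_length \<gamma> a (a + t) = ennreal a + ennreal t"
      using curve_length_add[of 0 a "a + t" \<gamma>] len[of a] len[of "a + t"] t assms by simp
    then show ?thesis by (simp add: curve_length_shift)
  qed
  moreover have "continuous_on {0..b - a} (\<lambda>t. \<gamma> (a + t))"
    by (rule continuous_on_compose2[OF cont]) (use assms in \<open>auto intro!: continuous_intros\<close>)
  ultimately show ?thesis using assms by (simp add: curves_def subcurve_def)
qed

section \<open>Line integrals\<close>

text \<open>
  Extending by zero turns line integrals into integrals over the whole line, for which the results on
  translation and completion can be used.
\<close>

lemma line_measurable_iff:
  "line_measurable (l, \<gamma>) g \<longleftrightarrow> (\<lambda>t. g (\<gamma> t) * indicator {0..l} t) \<in> borel_measurable lebesgue"
  by (simp add: line_measurable_def borel_measurable_restrict_space_iff_ennreal)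

lemma line_measurable_borel:
  assumes "\<gamma> \<in> curves" "g \<in> borel_measurable borel"
  shows "line_measurable \<gamma> g"
proof -
  obtain l \<eta> where \<gamma>: "\<gamma> = (l, \<eta>)" by (cases \<gamma>)
  have "continuous_on {0..l} \<eta>" using assms \<gamma> by (simp add: curves_def)
  then have "\<eta> \<in> borel_measurable (lebesgue_on {0..l})"
    by (simp add: continuous_imp_measurable_on_sets_lebesgue)
  then show ?thesis
    unfolding \<gamma> line_measurable_def using assms by simp
qed

lemma line_integral_subcurve:
  assumes "line_measurable (l, \<gamma>) g" "0 \<le> a" "b \<le> l"
  shows "line_integral (subcurve a b (l, \<gamma>)) g = (\<integral>\<^sup>+t\<in>{a..b}. g (\<gamma> t) \<partial>lebesgue)"
proof -
  have "(\<lambda>t. g (\<gamma> t) * indicator {0..l} t * indicator {a..b} t) \<in> borel_measurable lebesgue"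
    using assms(1) unfolding line_measurable_iff
    by (rule borel_measurable_times_ennreal) (auto intro: borel_measurable_indicator)
  moreover have "(\<lambda>t. g (\<gamma> t) * indicator {0..l} t * indicator {a..b} t)
      = (\<lambda>t. g (\<gamma> t) * indicator {a..b} t)"
    using assms by (auto simp: indicator_def)
  ultimately have "(\<integral>\<^sup>+t\<in>{a..b}. g (\<gamma> t) \<partial>lebesgue)
      = (\<integral>\<^sup>+t. g (\<gamma> (a + t)) * indicator {a..b} (a + t) \<partial>lebesgue)"
    by (simp add: nn_integral_real_affine_lebesgue[where c = 1 and t = a])
  also have "\<dots> = (\<integral>\<^sup>+t\<in>{0..b - a}. g (\<gamma> (a + t)) \<partial>lebesgue)"
    by (intro nn_integral_cong) (auto simp: indicator_def)
  finally show ?thesis by (simp add: subcurve_def line_integral_def)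
qed

lemma line_integral_subcurve_le:
  assumes "line_measurable (l, \<gamma>) g" "0 \<le> a" "b \<le> l"
  shows "line_integral (subcurve a b (l, \<gamma>)) g \<le> line_integral (l, \<gamma>) g"
  unfolding line_integral_subcurve[OF assms] using assms
  by (auto simp: line_integral_def indicator_def intro!: nn_integral_mono)

lemma line_integral_cmult:
  assumes "\<gamma> \<in> curves" "\<rho> \<in> borel_measurable borel"
  shows "line_integral \<gamma> (\<lambda>x. ennreal a * \<rho> x) = ennreal a * line_integral \<gamma> \<rho>"
  using line_measurable_borel[OF assms]
  by (cases \<gamma>) (simp add: line_measurable_iff line_integral_def nn_integral_cmult mult.assoc)

lemma line_integral_suminf:
  assumes "\<gamma> \<in> curves" "\<And>n. \<rho> n \<in> borel_measurable borel"
  shows "line_integral \<gamma> (\<lambda>x. \<Sum>n. \<rho> n x) = (\<Sum>n. line_integral \<gamma> (\<rho> n))"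
proof -
  obtain l \<eta> where \<gamma>: "\<gamma> = (l, \<eta>)" by (cases \<gamma>)
  have "(\<lambda>t. \<rho> n (\<eta> t) * indicator {0..l} t) \<in> borel_measurable lebesgue" for n
    using line_measurable_borel[OF assms] by (simp add: \<gamma> line_measurable_iff)
  then show ?thesis
    unfolding \<gamma> line_integral_def by (simp flip: nn_integral_suminf)
qed

lemma line_integral_mono:
  "(\<And>x. f x \<le> g x) \<Longrightarrow> line_integral \<gamma> f \<le> line_integral \<gamma> g"
  by (cases \<gamma>) (auto simp: line_integral_def intro!: nn_integral_mono mult_right_mono)

lemma line_measurable_min:
  assumes "line_measurable \<gamma> g" "line_measurable \<gamma> h"
  shows "line_measurable \<gamma> (\<lambda>x. min (g x) (h x))"
  using assms by (cases \<gamma>) (simp add: line_measurable_def)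

section \<open>Splicing bounds along a curve\<close>

text \<open>
  \<open>D a b\<close> stands for the oscillation \<open>\<bar>u (\<gamma> a) - u (\<gamma> b)\<bar>\<close>. The case \<open>a = b\<close> has to be left out, since the
  convention for infinite values of \<open>u\<close> makes \<open>D a a\<close> infinite there.
\<close>

definition gap_bounds :: "(real \<Rightarrow> real \<Rightarrow> ennreal) \<Rightarrow> real \<Rightarrow> (real \<Rightarrow> ennreal) set" where
  "gap_bounds D l = {F \<in> borel_measurable borel. (\<integral>\<^sup>+t\<in>{0..l}. F t \<partial>lborel) < \<infinity> \<and>
     (\<forall>a b. 0 \<le> a \<longrightarrow> a < b \<longrightarrow> b \<le> l \<longrightarrow> D a b \<le> (\<integral>\<^sup>+t\<in>{a..b}. F t \<partial>lborel))}"

lemma splice_integral_finite: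
  assumes [measurable]: "F \<in> borel_measurable borel" "H \<in> borel_measurable borel" "S \<in> sets borel"
    and "(\<integral>\<^sup>+t\<in>A. F t \<partial>lborel) < \<infinity>" "(\<integral>\<^sup>+t\<in>A. H t \<partial>lborel) < \<infinity>" "A \<in> sets borel"
  shows "(\<integral>\<^sup>+t\<in>A. (if t \<in> S then F t else H t) \<partial>lborel) < \<infinity>"
proof -
  note [measurable] = assms(6)
  have "(\<integral>\<^sup>+t\<in>A. (if t \<in> S then F t else H t) \<partial>lborel)
      \<le> (\<integral>\<^sup>+t. F t * indicator A t + H t * indicator A t \<partial>lborel)"
    by (intro nn_integral_mono) (auto simp: indicator_def)
  also have "\<dots> = (\<integral>\<^sup>+t\<in>A. F t \<partial>lborel) + (\<integral>\<^sup>+t\<in>A. H t \<partial>lborel)"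
    by (intro nn_integral_add) measurable
  also have "\<dots> < \<infinity>" using assms by simp
  finally show ?thesis .
qed

text \<open>
  For a half-line \<open>S\<close> the interval is cut at its end point and the triangle inequality applies. The sets
  \<open>S\<close> for which the claim holds for \<^emph>\<open>all\<close> pairs \<open>F\<close>, \<open>H\<close> form a sigma-algebra: complements exchange \<open>F\<close> and \<open>H\<close>,
  finite unions come from splicing repeatedly, which is why \<open>F\<close> and \<open>H\<close> are arbitrary in the induction, and
  countable unions follow by dominated convergence.
\<close>

lemma splice_gap_bounds:
  assumes "S \<in> sets borel"
    and tri: "\<And>a s b. 0 \<le> a \<Longrightarrow> a < s \<Longrightarrow> s < b \<Longrightarrow> b \<le> l \<Longrightarrow> D a b \<le> D a s + D s b"
    and "F \<in> gap_bounds D l" "H \<in> gap_bounds D l"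
  shows "(\<lambda>t. if t \<in> S then F t else H t) \<in> gap_bounds D l"
proof -
  have "S \<in> sigma_sets UNIV (range atMost)"
    using assms(1) by (simp add: borel_eq_atMost)
  then show ?thesis using assms(3,4)
  proof (induction S arbitrary: F H rule: sigma_sets.induct)
    case (Basic S)
    then obtain s :: real where S: "S = {..s}" by auto
    have [measurable]: "F \<in> borel_measurable borel" "H \<in> borel_measurable borel"
      using Basic by (auto simp: gap_bounds_def)
    let ?K = "\<lambda>t. if t \<in> S then F t else H t"
    have "D a b \<le> (\<integral>\<^sup>+t\<in>{a..b}. ?K t \<partial>lborel)" if ab: "0 \<le> a" "a < b" "b \<le> l" for a b
    proof -
      have F: "D a' b' \<le> (\<integral>\<^sup>+t\<in>{a'..b'}. F t \<partial>lborel)"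
        and H: "D a' b' \<le> (\<integral>\<^sup>+t\<in>{a'..b'}. H t \<partial>lborel)"
        if "0 \<le> a'" "a' < b'" "b' \<le> l" for a' b'
        using Basic.prems that by (auto simp: gap_bounds_def)
      consider "b \<le> s" | "s \<le> a" | "a < s" "s < b" by linarith
      then show ?thesis
      proof cases
        case 1
        then have "(\<integral>\<^sup>+t\<in>{a..b}. ?K t \<partial>lborel) = (\<integral>\<^sup>+t\<in>{a..b}. F t \<partial>lborel)"
          by (intro nn_integral_cong) (auto simp: S indicator_def)
        then show ?thesis using F[OF ab] by simp
      next
        case 2
        have "(\<integral>\<^sup>+t\<in>{a..b}. ?K t \<partial>lborel) = (\<integral>\<^sup>+t\<in>{a..b}. H t \<partial>lborel)"
          by (rule nn_integral_cong_AE, rule AE_mp[OF AE_lborel_singleton[of s]], rule AE_I2)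
            (use 2 in \<open>auto simp: S indicator_def\<close>)
        then show ?thesis using H[OF ab] by simp
      next
        case 3
        have "D a b \<le> (\<integral>\<^sup>+t\<in>{a..s}. F t \<partial>lborel) + (\<integral>\<^sup>+t\<in>{s..b}. H t \<partial>lborel)"
          using tri[of a s b] F[of a s] H[of s b] 3 ab by (meson add_mono less_imp_le order_trans)
        also have "\<dots> = (\<integral>\<^sup>+t. F t * indicator {a..s} t + H t * indicator {s..b} t \<partial>lborel)"
          by (intro nn_integral_add[symmetric]) measurable
        also have "\<dots> = (\<integral>\<^sup>+t\<in>{a..b}. ?K t \<partial>lborel)"
          by (rule nn_integral_cong_AE, rule AE_mp[OF AE_lborel_singleton[of s]], rule AE_I2)
            (use 3 in \<open>auto simp: S indicator_def\<close>)
        finally show ?thesis .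
      qed
    qed
    moreover have "(\<integral>\<^sup>+t\<in>{0..l}. ?K t \<partial>lborel) < \<infinity>"
      by (intro splice_integral_finite) (use Basic in \<open>auto simp: gap_bounds_def S\<close>)
    moreover have "?K \<in> borel_measurable borel" by (simp add: S)
    ultimately show ?case by (simp add: gap_bounds_def)
  next
    case Empty
    then show ?case by simp
  next
    case (Compl S)
    have "(\<lambda>t. if t \<in> UNIV - S then F t else H t) = (\<lambda>t. if t \<in> S then H t else F t)"
      by auto
    then show ?case using Compl.IH[OF Compl.prems(2,1)] by simp
  next
    case (Union A)
    have A: "A i \<in> sets borel" for i
      using Union.hyps by (simp add: borel_eq_atMost)
    note [measurable] = A
    have [measurable]: "F \<in> borel_measurable borel" "H \<in> borel_measurable borel"
      using Union.prems by (auto simp: gap_bounds_def)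
    let ?K = "\<lambda>t. if t \<in> (\<Union>i. A i) then F t else H t"
    define K where "K n t = (if t \<in> (\<Union>i<n. A i) then F t else H t)" for n t
    have K: "K n \<in> gap_bounds D l" for n
    proof (induction n)
      case 0
      then show ?case using Union.prems by (simp add: K_def)
    next
      case (Suc n)
      have "K (Suc n) = (\<lambda>t. if t \<in> A n then F t else K n t)"
        by (auto simp: K_def less_Suc_eq fun_eq_iff)
      then show ?case using Union.IH[OF Union.prems(1) Suc, of n] by simp
    qed
    have [measurable]: "K n \<in> borel_measurable borel" for n
      using K by (simp add: gap_bounds_def)
    have lim: "(\<lambda>n. K n t) \<longlonglongrightarrow> ?K t" for t
    proof (cases "t \<in> (\<Union>i. A i)")
      case True
      then obtain i where "t \<in> A i" by auto
      then have "K n t = ?K t" if "Suc i \<le> n" for n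
        using that by (auto simp: K_def)
      then show ?thesis
        by (intro tendsto_eventually eventually_sequentiallyI)
    qed (auto simp: K_def)
    have "D a b \<le> (\<integral>\<^sup>+t\<in>{a..b}. ?K t \<partial>lborel)" if ab: "0 \<le> a" "a < b" "b \<le> l" for a b
    proof -
      have fin: "(\<integral>\<^sup>+t. F t * indicator {0..l} t + H t * indicator {0..l} t \<partial>lborel) < \<infinity>"
        using Union.prems by (subst nn_integral_add) (auto simp: gap_bounds_def)
      have "(\<lambda>n. \<integral>\<^sup>+t\<in>{a..b}. K n t \<partial>lborel) \<longlonglongrightarrow> (\<integral>\<^sup>+t\<in>{a..b}. ?K t \<partial>lborel)"
      proof (rule nn_integral_dominated_convergence[OF _ _ _ _ fin])
        show "AE t in lborel. K j t * indicator {a..b} t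
            \<le> F t * indicator {0..l} t + H t * indicator {0..l} t" for j
          using ab by (intro AE_I2) (auto simp: K_def indicator_def)
        show "AE t in lborel. (\<lambda>n. K n t * indicator {a..b} t) \<longlonglongrightarrow> ?K t * indicator {a..b} t"
        proof (rule AE_I2)
          fix t
          show "(\<lambda>n. K n t * indicator {a..b} t) \<longlonglongrightarrow> ?K t * indicator {a..b} t"
            using lim[of t] by (cases "t \<in> {a..b}") simp_all
        qed
      qed measurable
      moreover have "D a b \<le> (\<integral>\<^sup>+t\<in>{a..b}. K n t \<partial>lborel)" for n
        using K[of n] ab by (simp add: gap_bounds_def)
      ultimately show ?thesis by (intro LIMSEQ_le_const) auto
    qed
    moreover have "(\<integral>\<^sup>+t\<in>{0..l}. ?K t \<partial>lborel) < \<infinity>"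
      by (intro splice_integral_finite) (use Union.prems in \<open>auto simp: gap_bounds_def\<close>)
    moreover have "?K \<in> borel_measurable borel" by measurable
    ultimately show ?case by (simp add: gap_bounds_def)
  qed
qed

lemma min_gap_bounds:
  assumes tri: "\<And>a s b. 0 \<le> a \<Longrightarrow> a < s \<Longrightarrow> s < b \<Longrightarrow> b \<le> l \<Longrightarrow> D a b \<le> D a s + D s b"
    and F: "F \<in> gap_bounds D l" and H: "H \<in> gap_bounds D l"
  shows "(\<lambda>t. min (F t) (H t)) \<in> gap_bounds D l"
proof -
  have [measurable]: "F \<in> borel_measurable borel" "H \<in> borel_measurable borel"
    using F H by (auto simp: gap_bounds_def)
  have "{t. F t \<le> H t} \<in> sets borel" by measurable
  from splice_gap_bounds[OF this tri F H] show ?thesis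
    by (simp add: min_def)
qed

lemma ereal_abs_diff_triangle: "\<bar>x - y\<bar> \<le> \<bar>x - z\<bar> + \<bar>z - y\<bar>" for x y z :: ereal
  by (cases x; cases y; cases z) auto

text \<open>
  The functions \<open>g \<circ> \<gamma>\<close> and \<open>h \<circ> \<gamma>\<close> are only Lebesgue measurable; they are replaced by Borel
  functions that are equal to them almost everywhere, to which \<open>min_gap_bounds\<close> applies.
\<close>

lemma end_gap_le_line_integral_min:
  assumes \<gamma>: "(l, \<gamma>) \<in> curves"
    and g: "line_measurable (l, \<gamma>) g" "line_integral (l, \<gamma>) g < \<infinity>"
    and h: "line_measurable (l, \<gamma>) h" "line_integral (l, \<gamma>) h < \<infinity>"
    and gap: "\<And>a b. 0 \<le> a \<Longrightarrow> a < b \<Longrightarrow> b \<le> l \<Longrightarrow>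
      end_gap u (subcurve a b (l, \<gamma>)) \<le> line_integral (subcurve a b (l, \<gamma>)) g \<and>
      end_gap u (subcurve a b (l, \<gamma>)) \<le> line_integral (subcurve a b (l, \<gamma>)) h"
  shows "end_gap u (l, \<gamma>) \<le> line_integral (l, \<gamma>) (\<lambda>x. min (g x) (h x))"
proof -
  define D where "D a b = end_gap u (subcurve a b (l, \<gamma>))" for a b
  have tri: "D a b \<le> D a s + D s b" for a s b
    unfolding D_def end_gap_subcurve
    by (simp add: less_eq_ennreal.rep_eq plus_ennreal.rep_eq enn2ereal_e2ennreal
        ereal_abs_diff_triangle)
  obtain G where [measurable]: "G \<in> borel_measurable borel"
    and G: "AE t in lborel. g (\<gamma> t) * indicator {0..l} t = G t"
    using completion_ex_borel_measurable[of _ lborel] g(1) unfolding line_measurable_iff by auto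
  obtain H where [measurable]: "H \<in> borel_measurable borel"
    and H: "AE t in lborel. h (\<gamma> t) * indicator {0..l} t = H t"
    using completion_ex_borel_measurable[of _ lborel] h(1) unfolding line_measurable_iff by auto
  have G_int: "(\<integral>\<^sup>+t\<in>{a..b}. g (\<gamma> t) \<partial>lebesgue) = (\<integral>\<^sup>+t\<in>{a..b}. G t \<partial>lborel)"
    if "0 \<le> a" "b \<le> l" for a b
    unfolding nn_integral_completion
    by (rule nn_integral_cong_AE, rule AE_mp[OF G], rule AE_I2)
      (use that in \<open>auto simp: indicator_def split: if_splits\<close>)
  have H_int: "(\<integral>\<^sup>+t\<in>{a..b}. h (\<gamma> t) \<partial>lebesgue) = (\<integral>\<^sup>+t\<in>{a..b}. H t \<partial>lborel)"
    if "0 \<le> a" "b \<le> l" for a b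
    unfolding nn_integral_completion
    by (rule nn_integral_cong_AE, rule AE_mp[OF H], rule AE_I2)
      (use that in \<open>auto simp: indicator_def split: if_splits\<close>)
  have l: "0 < l" using \<gamma> by (simp add: curves_def)
  have fin: "(\<integral>\<^sup>+t\<in>{0..l}. G t \<partial>lborel) < \<infinity>" "(\<integral>\<^sup>+t\<in>{0..l}. H t \<partial>lborel) < \<infinity>"
    using g(2) h(2) G_int[of 0 l] H_int[of 0 l] by (simp_all add: line_integral_def)
  have "G \<in> gap_bounds D l" "H \<in> gap_bounds D l"
    using gap l g(1) h(1) fin
    by (auto simp: gap_bounds_def D_def line_integral_subcurve G_int H_int)
  then have "(\<lambda>t. min (G t) (H t)) \<in> gap_bounds D l"
    by (rule min_gap_bounds[OF tri])
  then have "D 0 l \<le> (\<integral>\<^sup>+t\<in>{0..l}. min (G t) (H t) \<partial>lborel)"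
    using l by (simp add: gap_bounds_def)
  also have "\<dots> = (\<integral>\<^sup>+t\<in>{0..l}. min (g (\<gamma> t)) (h (\<gamma> t)) \<partial>lebesgue)"
    unfolding nn_integral_completion
    by (rule nn_integral_cong_AE, rule AE_mp[OF G], rule AE_mp[OF H], rule AE_I2)
      (auto simp: indicator_def split: if_splits)
  finally show ?thesis by (simp add: D_def line_integral_def)
qed

section \<open>Non-negative functions in the lattice\<close>

lemma eq_0_if_le_small_multiples:
  fixes x y :: ennreal
  assumes "\<And>k::nat. x \<le> ennreal (inverse (real (Suc k))) * y" "y < \<infinity>"
  shows "x = 0"
proof -
  obtain r where r: "0 \<le> r" "y = ennreal r" using assms(2) by (cases y) auto
  have "(\<lambda>k. inverse (real (Suc k)) * r) \<longlonglongrightarrow> 0 * r"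
    by (intro tendsto_mult_right LIMSEQ_inverse_real_of_nat)
  then have "(\<lambda>k. ennreal (inverse (real (Suc k)) * r)) \<longlonglongrightarrow> 0"
    using tendsto_ennrealI by fastforce
  moreover have "x \<le> ennreal (inverse (real (Suc k)) * r)" for k
    using assms(1)[of k] r by (simp add: ennreal_mult)
  ultimately have "x \<le> 0" by (intro LIMSEQ_le_const) auto
  then show ?thesis by simp
qed

lemma inverse_le_inverse_ennreal:
  "a \<le> b \<Longrightarrow> inverse b \<le> inverse a" for a b :: ennreal
  by (simp add: less_eq_ennreal.rep_eq inverse_ennreal.rep_eq ereal_inverse_antimono)

lemma ennreal_inverse_inject: "inverse a = inverse b \<Longrightarrow> a = b" for a b :: ennreal
proof -
  have "inverse (inverse x) = x" for x :: ennreal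
    by (cases x; cases "x = 0") (auto simp: inverse_ennreal ennreal_inverse_eq_top_iff)
  then show "inverse a = inverse b \<Longrightarrow> a = b" by metis
qed

lemma (in complete_measure) borel_measurable_cong_AE:
  fixes f g :: "'a \<Rightarrow> 'b::topological_space"
  assumes "f \<in> borel_measurable M" "AE x in M. g x = f x"
  shows "g \<in> borel_measurable M"
proof (rule measurableI)
  fix S :: "'b set" assume "S \<in> sets borel"
  then have "f -` S \<inter> space M \<in> sets M" by (rule measurable_sets[OF assms(1)])
  moreover have "AE x in M. x \<in> f -` S \<inter> space M \<longleftrightarrow> x \<in> g -` S \<inter> space M"
    using assms(2) by eventually_elim auto
  ultimately show "g -` S \<inter> space M \<in> sets M"
    using in_sets_AE by blast
qed simp

locale function_lattice_on_space =
  borel_regular_space M + quasi_banach_function_lattice M N c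
  for M :: "'a::metric_space measure" and N :: "('a \<Rightarrow> ereal) \<Rightarrow> ennreal" and c :: real
begin

abbreviation qnorm :: "('a \<Rightarrow> ennreal) \<Rightarrow> ennreal" where
  "qnorm g \<equiv> N (\<lambda>x. enn2ereal (g x))"

lemma borel_measurable_imp_measurable:
  "f \<in> borel_measurable borel \<Longrightarrow> f \<in> borel_measurable M"
  by (rule borel_measurable_subalgebra[OF borel_sets]) (simp_all add: space_M)

lemma qnorm_mono:
  assumes "f \<in> borel_measurable M" "g \<in> borel_measurable M" "AE x in M. f x \<le> g x"
  shows "qnorm f \<le> qnorm g"
  using assms by (intro lattice) (auto simp: less_eq_ennreal.rep_eq)

lemma qnorm_cmult:
  assumes "f \<in> borel_measurable M" "0 \<le> a"
  shows "qnorm (\<lambda>x. ennreal a * f x) = ennreal a * qnorm f"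
  using scale[of "\<lambda>x. enn2ereal (f x)" a] assms by (simp add: times_ennreal.rep_eq)

lemma qnorm_add:
  assumes "f \<in> borel_measurable M" "g \<in> borel_measurable M"
  shows "qnorm (\<lambda>x. f x + g x) \<le> ennreal c * (qnorm f + qnorm g)"
  using triangle[of "\<lambda>x. enn2ereal (f x)" "\<lambda>x. enn2ereal (g x)"] assms
  by (simp add: plus_ennreal.rep_eq)

lemma qnorm_suminf:
  assumes "\<And>n. f n \<in> borel_measurable M"
  shows "qnorm (\<lambda>x. \<Sum>n. f n x) \<le> (\<Sum>n. ennreal c ^ Suc n * qnorm (f n))"
  using riesz_fischer[of "\<lambda>n x. enn2ereal (f n x)"] assms by simp

lemma qnorm_eq_0:
  assumes "f \<in> borel_measurable M"
  shows "qnorm f = 0 \<longleftrightarrow> (AE x in M. f x = 0)"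
  proof -
  have "enn2ereal y = 0 \<longleftrightarrow> y = 0" for y
    by (metis enn2ereal_inject zero_ennreal.rep_eq)
  then show ?thesis using zero_iff[of "\<lambda>x. enn2ereal (f x)"] assms by simp
qed

lemma nonneg_fun_space_iff:
  "g \<in> nonneg_fun_space M N \<longleftrightarrow> g \<in> borel_measurable M \<and> qnorm g < \<infinity>"
proof -
  have "g \<in> borel_measurable M" if "(\<lambda>x. enn2ereal (g x)) \<in> borel_measurable M"
    using measurable_compose[OF that measurable_e2ennreal] by simp
  moreover have "(\<lambda>x. enn2ereal (g x)) \<in> borel_measurable M" if "g \<in> borel_measurable M"
    using measurable_compose[OF that measurable_enn2ereal] .
  ultimately show ?thesis
    unfolding nonneg_fun_space_def fun_space_def by blast
qed

text \<open>
  The function that is \<open>\<infinity>\<close> where \<open>g = \<infinity>\<close> and 0 elsewhere is at most \<open>g / k\<close> for all \<open>k\<close>, so its quasi-norm is 0.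
\<close>

lemma finite_AE:
  assumes [measurable]: "g \<in> borel_measurable M" and "qnorm g < \<infinity>"
  shows "AE x in M. g x < \<infinity>"
proof -
  define f :: "'a \<Rightarrow> ennreal" where "f x = (if g x = top then top else 0)" for x
  have [measurable]: "f \<in> borel_measurable M" unfolding f_def by measurable
  have "qnorm f \<le> ennreal (inverse (real (Suc k))) * qnorm g" for k
  proof -
    have "qnorm f \<le> qnorm (\<lambda>x. ennreal (inverse (real (Suc k))) * g x)"
      by (intro qnorm_mono) (auto simp: f_def ennreal_mult_eq_top_iff top_unique)
    then show ?thesis by (simp add: qnorm_cmult)
  qed
  then have "qnorm f = 0" using assms(2) by (rule eq_0_if_le_small_multiples)
  then have "AE x in M. f x = 0" by (simp add: qnorm_eq_0)
  then show ?thesis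
    by eventually_elim (auto simp: f_def less_top split: if_splits)
qed

text \<open>
  The bound on the terms cancels the weight \<open>c ^ Suc n\<close> in the Riesz-Fischer property and leaves a
  geometric series.
\<close>

lemma qnorm_suminf_finite:
  assumes "\<And>n. f n \<in> borel_measurable M" "\<And>n. qnorm (f n) \<le> ennreal ((1 / 2) ^ n / c ^ Suc n)"
  shows "qnorm (\<lambda>x. \<Sum>n. f n x) < \<infinity>"
proof -
  have "ennreal c ^ Suc n * qnorm (f n) \<le> ennreal ((1 / 2) ^ n)" for n
  proof -
    have "ennreal c ^ Suc n * qnorm (f n) \<le> ennreal c ^ Suc n * ennreal ((1 / 2) ^ n / c ^ Suc n)"
      by (intro mult_left_mono assms) simp
    also have "\<dots> = ennreal (c ^ Suc n * ((1 / 2) ^ n / c ^ Suc n))"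
      using modulus_ge_1 by (subst ennreal_mult) (simp_all add: ennreal_power del: power_Suc)
    also have "c ^ Suc n * ((1 / 2) ^ n / c ^ Suc n) = (1 / 2) ^ n"
      using modulus_ge_1 by simp
    finally show ?thesis .
  qed
  then have "(\<Sum>n. ennreal c ^ Suc n * qnorm (f n)) \<le> (\<Sum>n. ennreal ((1 / 2) ^ n))"
    by (intro suminf_le) auto
  also have "\<dots> = ennreal (\<Sum>n. (1 / 2) ^ n)"
    by (intro suminf_ennreal2) auto
  also have "\<dots> < \<infinity>" by simp
  finally show ?thesis using qnorm_suminf[of f] assms(1) le_less_trans by blast
qed

section \<open>Borel hulls and Borel majorants\<close>

text \<open>
  Borel regularity alone gives a hull of equal measure, which is informative only for sets of finite
  measure; sigma-finiteness extends the conclusion to all measurable sets.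
\<close>

lemma borel_hull:
  assumes "A \<in> sets M"
  shows "\<exists>D\<in>sets borel. A \<subseteq> D \<and> D - A \<in> null_sets M"
proof -
  obtain F :: "nat \<Rightarrow> 'a set" where F: "range F \<subseteq> sets M" "(\<Union>i. F i) = space M"
    "\<And>i. emeasure M (F i) \<noteq> \<infinity>"
    using sigma_finite by blast
  have sets: "A \<inter> F i \<in> sets M" for i using F assms by auto
  then have "\<forall>i. \<exists>D\<in>sets borel. A \<inter> F i \<subseteq> D \<and> emeasure M D = emeasure M (A \<inter> F i)"
    using borel_regular by blast
  then obtain D where D: "\<And>i. D i \<in> sets borel" "\<And>i. A \<inter> F i \<subseteq> D i"
    "\<And>i. emeasure M (D i) = emeasure M (A \<inter> F i)"
    by metis
  have DM: "D i \<in> sets M" for i using D borel_sets by auto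
  have "D i - A \<inter> F i \<in> null_sets M" for i
  proof -
    have "emeasure M (A \<inter> F i) \<noteq> \<infinity>"
      using F emeasure_mono[of "A \<inter> F i" "F i" M] by (auto simp: top_unique)
    then show ?thesis
      using D DM sets by (intro null_setsI) (auto simp: emeasure_Diff)
  qed
  then have "(\<Union>i. D i - A \<inter> F i) \<in> null_sets M" by (rule null_sets_UN)
  moreover have "(\<Union>i. D i) - A \<subseteq> (\<Union>i. D i - A \<inter> F i)" by blast
  ultimately have "(\<Union>i. D i) - A \<in> null_sets M" by (rule complete2[rotated])
  moreover have "A \<subseteq> (\<Union>i. A \<inter> F i)" using F(2) space_M by auto
  then have "A \<subseteq> (\<Union>i. D i)" using D(2) by blast
  ultimately show ?thesis using D(1) by (intro bexI[of _ "\<Union>i. D i"]) auto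
qed

lemma borel_null_hull:
  assumes "AE x in M. P x"
  obtains D where "D \<in> sets borel" "D \<in> null_sets M" "\<And>x. x \<notin> D \<Longrightarrow> P x"
proof -
  have "{x. \<not> P x} \<in> null_sets M"
    using assms by (simp add: AE_iff_null_sets space_M)
  moreover from this obtain D where "D \<in> sets borel" "{x. \<not> P x} \<subseteq> D" "D - {x. \<not> P x} \<in> null_sets M"
    using borel_hull by blast
  ultimately have "D \<in> null_sets M"
    using null_sets.Un[of "{x. \<not> P x}" M "D - {x. \<not> P x}"] by (simp add: Un_absorb1)
  with \<open>D \<in> sets borel\<close> \<open>{x. \<not> P x} \<subseteq> D\<close> that show ?thesis by blast
qed

text \<open>
  The majorant is the supremum of the rational multiples \<open>q \<cdot> 1\<^sub>D\<close>, where \<open>D\<close> is a Borel hull of \<open>{g > q}\<close>.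
  It dominates \<open>g\<close> everywhere and not merely almost everywhere, and so it controls \<open>g\<close> along every curve.
\<close>

lemma borel_majorant:
  fixes g :: "'a \<Rightarrow> ennreal"
  assumes [measurable]: "g \<in> borel_measurable M"
  obtains g' where "g' \<in> borel_measurable borel" "\<And>x. g x \<le> g' x" "AE x in M. g' x = g x"
proof -
  define A where "A q = {x. ennreal (real_of_rat q) < g x}" for q
  have "A q \<in> sets M" for q
  proof -
    have "{x\<in>space M. ennreal (real_of_rat q) < g x} \<in> sets M" by measurable
    then show ?thesis by (simp add: A_def space_M)
  qed
  then have "\<forall>q. \<exists>D\<in>sets borel. A q \<subseteq> D \<and> D - A q \<in> null_sets M"
    using borel_hull by blast
  then obtain D where [measurable]: "\<And>q. D q \<in> sets borel" and D: "\<And>q. A q \<subseteq> D q"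
    "\<And>q. D q - A q \<in> null_sets M"
    by metis
  define g' where "g' x = (SUP q. ennreal (real_of_rat q) * indicator (D q) x)" for x
  have "g' \<in> borel_measurable borel"
    unfolding g'_def by measurable
  moreover have "g x \<le> g' x" for x
  proof (rule ccontr)
    assume "\<not> g x \<le> g' x"
    then have "g' x < g x" by simp
    then obtain y where y: "g' x < y" "y < g x" using dense by blast
    then obtain r where r: "y = ennreal r" "0 \<le> r" by (cases y) auto
    obtain s where s: "y < ennreal s" "ennreal s < g x" "0 \<le> s"
      using y dense[of y "g x"] by (metis ennreal_cases less_top not_less top_greatest)
    have "r < s" using r s by (simp add: ennreal_less_iff)
    then obtain q where q: "r < real_of_rat q" "real_of_rat q < s" using of_rat_dense by blast
    then have "x \<in> A q"
      using s le_less_trans[OF ennreal_leI[of "real_of_rat q" s]] by (simp add: A_def)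
    then have "x \<in> D q" using D by auto
    then have "ennreal (real_of_rat q) \<le> g' x"
      unfolding g'_def by (intro SUP_upper2[of q]) auto
    moreover have "y \<le> ennreal (real_of_rat q)" using q r by (simp add: ennreal_leI)
    ultimately show False using y by (meson leD order_trans)
  qed
  moreover have "AE x in M. g' x = g x"
  proof -
    have "AE x in M. \<forall>q. x \<notin> D q - A q"
      using D(2) by (intro AE_all_countable[THEN iffD2] allI AE_not_in)
    then show ?thesis
    proof eventually_elim
      case (elim x)
      have "ennreal (real_of_rat q) * indicator (D q) x \<le> g x" for q
        using elim[rule_format, of q] by (auto simp: A_def indicator_def)
      then show ?case
        using \<open>\<And>x. g x \<le> g' x\<close>[of x] unfolding g'_def by (intro antisym SUP_least) auto
    qed
  qed
  ultimately show ?thesis by (rule that)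
qed

section \<open>Exceptional families of curves\<close>

text \<open>
  The multiples \<open>\<rho> / k\<close> are all admissible for the family of curves on which \<open>\<integral> \<rho> ds\<close> is infinite. Together
  with the converse \<open>almost_every_curveE\<close> this replaces the modulus by a single function of finite
  quasi-norm, which is the form used throughout.
\<close>

lemma almost_every_curveI:
  assumes [measurable]: "\<rho> \<in> borel_measurable borel" and "qnorm \<rho> < \<infinity>"
    and P: "\<And>\<gamma>. \<gamma> \<in> curves \<Longrightarrow> line_integral \<gamma> \<rho> < \<infinity> \<Longrightarrow> P \<gamma>"
  shows "almost_every_curve N P"
proof -
  have "curve_modulus N {\<gamma> \<in> curves. \<not> P \<gamma>} \<le> ennreal (inverse (real (Suc k))) * qnorm \<rho>" for k
  proof -
    let ?\<rho> = "\<lambda>x. ennreal (inverse (real (Suc k))) * \<rho> x"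
    have "1 \<le> line_integral \<gamma> ?\<rho>" if "\<gamma> \<in> curves" "\<not> P \<gamma>" for \<gamma>
    proof -
      have "line_integral \<gamma> \<rho> = top" using P[OF that(1)] that(2) less_top by (metis infinity_ennreal_def)
      then show ?thesis using that by (simp add: line_integral_cmult ennreal_mult_top)
    qed
    then have "curve_modulus N {\<gamma> \<in> curves. \<not> P \<gamma>} \<le> qnorm ?\<rho>"
      unfolding curve_modulus_def by (intro INF_lower) auto
    then show ?thesis by (simp add: qnorm_cmult borel_measurable_imp_measurable)
  qed
  then show ?thesis
    unfolding almost_every_curve_def using assms(2) by (rule eq_0_if_le_small_multiples)
qed

text \<open>
  Summing admissible functions of rapidly decreasing quasi-norm gives a function in \<open>X\<close> whose integral
  over each exceptional curve is a series with infinitely many terms at least 1.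
\<close>

lemma almost_every_curveE:
  assumes "almost_every_curve N P"
  obtains \<rho> where "\<rho> \<in> borel_measurable borel" "qnorm \<rho> < \<infinity>"
    "\<And>\<gamma>. \<gamma> \<in> curves \<Longrightarrow> line_integral \<gamma> \<rho> < \<infinity> \<Longrightarrow> P \<gamma>"
proof -
  let ?A = "{\<rho> \<in> borel_measurable borel. \<forall>\<gamma>\<in>{\<gamma> \<in> curves. \<not> P \<gamma>}. 1 \<le> line_integral \<gamma> \<rho>}"
  have "\<exists>\<rho>\<in>?A. qnorm \<rho> < ennreal ((1 / 2) ^ n / c ^ Suc n)" for n
  proof -
    have "(INF \<rho>\<in>?A. qnorm \<rho>) < ennreal ((1 / 2) ^ n / c ^ Suc n)"
      using assms modulus_ge_1 by (simp add: almost_every_curve_def curve_modulus_def)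
    then show ?thesis by (simp only: INF_less_iff)
  qed
  then have "\<forall>n. \<exists>\<rho>. \<rho> \<in> ?A \<and> qnorm \<rho> < ennreal ((1 / 2) ^ n / c ^ Suc n)" by blast
  then obtain \<rho> where "\<forall>n. \<rho> n \<in> ?A \<and> qnorm (\<rho> n) < ennreal ((1 / 2) ^ n / c ^ Suc n)"
    by (rule choice[THEN exE])
  then have \<rho>: "\<And>n. \<rho> n \<in> ?A" "\<And>n. qnorm (\<rho> n) < ennreal ((1 / 2) ^ n / c ^ Suc n)"
    by blast+
  have [measurable]: "\<rho> n \<in> borel_measurable borel" for n using \<rho> by auto
  show ?thesis
  proof
    show "(\<lambda>x. \<Sum>n. \<rho> n x) \<in> borel_measurable borel" by measurable
    show "qnorm (\<lambda>x. \<Sum>n. \<rho> n x) < \<infinity>"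
      using \<rho>(2) by (intro qnorm_suminf_finite borel_measurable_imp_measurable) (auto intro: less_imp_le)
    fix \<gamma> :: "real \<times> (real \<Rightarrow> 'a)" assume \<gamma>: "\<gamma> \<in> curves" "line_integral \<gamma> (\<lambda>x. \<Sum>n. \<rho> n x) < \<infinity>"
    show "P \<gamma>"
    proof (rule ccontr)
      assume "\<not> P \<gamma>"
      then have "1 \<le> line_integral \<gamma> (\<rho> n)" for n using \<rho>(1)[of n] \<gamma>(1) by blast
      then have "of_nat n \<le> (\<Sum>n. line_integral \<gamma> (\<rho> n))" for n
        using sum_mono[of "{..<n}" "\<lambda>_. 1" "\<lambda>n. line_integral \<gamma> (\<rho> n)"]
          sum_le_suminf[of "\<lambda>n. line_integral \<gamma> (\<rho> n)" "{..<n}"]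
        by (auto intro: order_trans)
      moreover obtain n :: nat where "(\<Sum>n. line_integral \<gamma> (\<rho> n)) < of_nat n"
        using \<gamma> ennreal_Ex_less_of_nat[of "\<Sum>n. line_integral \<gamma> (\<rho> n)"]
        by (auto simp: line_integral_suminf)
      ultimately show False by (simp add: leD)
    qed
  qed
qed

lemma almost_every_curve_mono:
  assumes "almost_every_curve N P" "\<And>\<gamma>. \<gamma> \<in> curves \<Longrightarrow> P \<gamma> \<Longrightarrow> Q \<gamma>"
  shows "almost_every_curve N Q"
proof -
  from assms(1) obtain \<rho> where "\<rho> \<in> borel_measurable borel" "qnorm \<rho> < \<infinity>"
    "\<And>\<gamma>. \<gamma> \<in> curves \<Longrightarrow> line_integral \<gamma> \<rho> < \<infinity> \<Longrightarrow> P \<gamma>"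
    by (rule almost_every_curveE) blast
  with assms(2) show ?thesis by (intro almost_every_curveI) blast+
qed

text \<open>
  The functions of the single families are summed after scaling by positive weights \<open>w n\<close> that make
  the sum of finite quasi-norm; a positive weight does not change on which curves an integral is infinite.
\<close>

lemma almost_every_curve_countable:
  assumes "\<And>n::nat. almost_every_curve N (P n)"
  shows "almost_every_curve N (\<lambda>\<gamma>. \<forall>n. P n \<gamma>)"
proof -
  have "\<forall>n. \<exists>\<rho>. \<rho> \<in> borel_measurable borel \<and> qnorm \<rho> < \<infinity> \<and>
      (\<forall>\<gamma>\<in>curves. line_integral \<gamma> \<rho> < \<infinity> \<longrightarrow> P n \<gamma>)"
  proof
    fix n
    from assms[of n] show "\<exists>\<rho>. \<rho> \<in> borel_measurable borel \<and> qnorm \<rho> < \<infinity> \<and>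
        (\<forall>\<gamma>\<in>curves. line_integral \<gamma> \<rho> < \<infinity> \<longrightarrow> P n \<gamma>)"
      by (rule almost_every_curveE) blast
  qed
  then obtain \<rho> where \<rho>: "\<forall>n. \<rho> n \<in> borel_measurable borel \<and> qnorm (\<rho> n) < \<infinity> \<and>
      (\<forall>\<gamma>\<in>curves. line_integral \<gamma> (\<rho> n) < \<infinity> \<longrightarrow> P n \<gamma>)"
    by (rule choice[THEN exE])
  have [measurable]: "\<rho> n \<in> borel_measurable borel"
    and fin: "qnorm (\<rho> n) < \<infinity>"
    and P: "\<gamma> \<in> curves \<Longrightarrow> line_integral \<gamma> (\<rho> n) < \<infinity> \<Longrightarrow> P n \<gamma>" for n \<gamma>
    using \<rho> by blast+
  define w where "w n = (1 / 2) ^ n / c ^ Suc n / (enn2real (qnorm (\<rho> n)) + 1)" for n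
  have w: "0 < w n" for n
    unfolding w_def using modulus_ge_1 by (intro divide_pos_pos) (auto intro: add_nonneg_pos)
  have small: "qnorm (\<lambda>x. ennreal (w n) * \<rho> n x) \<le> ennreal ((1 / 2) ^ n / c ^ Suc n)" for n
  proof -
    obtain r where r: "0 \<le> r" "qnorm (\<rho> n) = ennreal r" using fin[of n] by (cases "qnorm (\<rho> n)") auto
    have "w n * r = (1 / 2) ^ n / c ^ Suc n * (r / (r + 1))"
      using r by (simp add: w_def)
    also have "\<dots> \<le> (1 / 2) ^ n / c ^ Suc n * 1"
      using r modulus_ge_1 by (intro mult_left_mono) auto
    finally show ?thesis
      using r w[of n]
      by (simp add: qnorm_cmult borel_measurable_imp_measurable ennreal_leI flip: ennreal_mult)
  qed
  show ?thesis
  proof (rule almost_every_curveI)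
    show "(\<lambda>x. \<Sum>n. ennreal (w n) * \<rho> n x) \<in> borel_measurable borel" by measurable
    show "qnorm (\<lambda>x. \<Sum>n. ennreal (w n) * \<rho> n x) < \<infinity>"
      using small by (intro qnorm_suminf_finite borel_measurable_imp_measurable) auto
    fix \<gamma> :: "real \<times> (real \<Rightarrow> 'a)"
    assume \<gamma>: "\<gamma> \<in> curves" "line_integral \<gamma> (\<lambda>x. \<Sum>n. ennreal (w n) * \<rho> n x) < \<infinity>"
    show "\<forall>n. P n \<gamma>"
    proof
      fix n
      have "(\<Sum>n. ennreal (w n) * line_integral \<gamma> (\<rho> n)) < \<infinity>"
        using \<gamma> by (simp add: line_integral_suminf line_integral_cmult)
      then have "ennreal (w n) * line_integral \<gamma> (\<rho> n) < \<infinity>"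
        using ennreal_suminf_lessD by fastforce
      then have "line_integral \<gamma> (\<rho> n) < \<infinity>"
        using w[of n] by (auto simp: ennreal_mult_less_top)
      then show "P n \<gamma>" using P \<gamma>(1) by blast
    qed
  qed
qed

lemma almost_every_curve_conj:
  assumes "almost_every_curve N P" "almost_every_curve N Q"
  shows "almost_every_curve N (\<lambda>\<gamma>. P \<gamma> \<and> Q \<gamma>)"
proof -
  have "almost_every_curve N (\<lambda>\<gamma>. \<forall>n::nat. if n = 0 then P \<gamma> else Q \<gamma>)"
  proof (rule almost_every_curve_countable)
    show "almost_every_curve N (\<lambda>\<gamma>. if n = 0 then P \<gamma> else Q \<gamma>)" for n :: nat
      using assms by (cases "n = 0") simp_all
  qed
  then show ?thesis by (rule almost_every_curve_mono) (metis zero_neq_one)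
qed

text \<open>
  A function with infinite integral over a subcurve has infinite integral over the whole curve.
\<close>

lemma almost_every_curve_subcurves:
  assumes "almost_every_curve N P"
  shows "almost_every_curve N
    (\<lambda>(l, \<gamma>). \<forall>a b. 0 \<le> a \<longrightarrow> a < b \<longrightarrow> b \<le> l \<longrightarrow> P (subcurve a b (l, \<gamma>)))"
proof -
  obtain \<rho> where \<rho>: "\<rho> \<in> borel_measurable borel" "qnorm \<rho> < \<infinity>"
    "\<And>\<gamma>. \<gamma> \<in> curves \<Longrightarrow> line_integral \<gamma> \<rho> < \<infinity> \<Longrightarrow> P \<gamma>"
    using assms by (rule almost_every_curveE) blast
  show ?thesis
  proof (rule almost_every_curveI[OF \<rho>(1,2)], safe)
    fix l and \<gamma> :: "real \<Rightarrow> 'a" and a b :: real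
    assume \<gamma>: "(l, \<gamma>) \<in> curves" "line_integral (l, \<gamma>) \<rho> < \<infinity>" and ab: "0 \<le> a" "a < b" "b \<le> l"
    then have "line_integral (subcurve a b (l, \<gamma>)) \<rho> < \<infinity>"
      using le_less_trans[OF line_integral_subcurve_le[OF line_measurable_borel[OF \<gamma>(1) \<rho>(1)] ab(1,3)] \<gamma>(2)]
      by simp
    then show "P (subcurve a b (l, \<gamma>))"
      using \<rho>(3) subcurve_in_curves[OF \<gamma>(1) ab] by blast
  qed
qed

lemma almost_every_curve_finite_integral:
  assumes "g \<in> nonneg_fun_space M N"
  shows "almost_every_curve N (\<lambda>\<gamma>. line_integral \<gamma> g < \<infinity>)"
proof -
  have g: "g \<in> borel_measurable M" "qnorm g < \<infinity>"
    using assms by (auto simp: nonneg_fun_space_iff)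
  from borel_majorant[OF g(1)] obtain g' where g': "g' \<in> borel_measurable borel"
    "\<And>x. g x \<le> g' x" "AE x in M. g' x = g x" by blast
  have "qnorm g' \<le> qnorm g"
    using g g' by (intro qnorm_mono) (auto intro: borel_measurable_imp_measurable)
  then show ?thesis
    using g g' by (intro almost_every_curveI[of g'])
      (auto intro: le_less_trans line_integral_mono)
qed

text \<open>
  With \<open>D\<close> a Borel null set containing the exceptional points, \<open>\<infinity> \<cdot> 1\<^sub>D\<close> has quasi-norm 0, and its integral is
  infinite over each curve that spends positive length in \<open>D\<close>.
\<close>

lemma almost_every_curve_AE:
  assumes "AE x in M. P x"
  shows "almost_every_curve N (\<lambda>(l, \<gamma>). AE t in lebesgue. t \<in> {0..l} \<longrightarrow> P (\<gamma> t))"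
proof -
  from borel_null_hull[OF assms] obtain D where D: "D \<in> sets borel" "D \<in> null_sets M"
    "\<And>x. x \<notin> D \<Longrightarrow> P x" by blast
  define \<rho> :: "'a \<Rightarrow> ennreal" where "\<rho> x = top * indicator D x" for x
  have \<rho>: "\<rho> \<in> borel_measurable borel"
    unfolding \<rho>_def using D(1) by measurable
  have "AE x in M. \<rho> x = 0"
    using AE_not_in[OF D(2)] by eventually_elim (simp add: \<rho>_def)
  then have "qnorm \<rho> = 0" using \<rho> by (simp add: qnorm_eq_0 borel_measurable_imp_measurable)
  then show ?thesis
  proof (intro almost_every_curveI[OF \<rho>], simp, safe)
    fix l and \<gamma> :: "real \<Rightarrow> 'a" assume \<gamma>: "(l, \<gamma>) \<in> curves" "line_integral (l, \<gamma>) \<rho> < \<infinity>"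
    have "AE t in lebesgue. \<rho> (\<gamma> t) * indicator {0..l} t \<noteq> \<infinity>"
      using \<gamma> line_measurable_borel[OF \<gamma>(1) \<rho>]
      by (intro nn_integral_PInf_AE) (auto simp: line_measurable_iff line_integral_def)
    then show "AE t in lebesgue. t \<in> {0..l} \<longrightarrow> P (\<gamma> t)"
    proof eventually_elim
      case (elim t)
      show ?case
        using elim D(3)[of "\<gamma> t"] by (cases "\<gamma> t \<in> D") (auto simp: \<rho>_def)
    qed
  qed
qed

end

section \<open>Weak upper gradients\<close>

definition upper_gradient_along :: "('a \<Rightarrow> ereal) \<Rightarrow> ('a \<Rightarrow> ennreal) \<Rightarrow> real \<times> (real \<Rightarrow> 'a) \<Rightarrow> bool" where
  "upper_gradient_along u g \<gamma> \<longleftrightarrow> line_measurable \<gamma> g \<and> end_gap u \<gamma> \<le> line_integral \<gamma> g"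

lemma weak_upper_gradient_iff:
  "weak_upper_gradient M N u g \<longleftrightarrow>
    g \<in> borel_measurable M \<and> almost_every_curve N (upper_gradient_along u g)"
  by (simp add: weak_upper_gradient_def upper_gradient_along_def[abs_def])

context function_lattice_on_space
begin

lemma nonneg_fun_space_mono:
  assumes "g \<in> nonneg_fun_space M N" "f \<in> borel_measurable M" "AE x in M. f x \<le> g x"
  shows "f \<in> nonneg_fun_space M N"
  using assms qnorm_mono[of f g] by (auto simp: nonneg_fun_space_iff intro: le_less_trans)

lemma nonneg_fun_space_add_cmult:
  assumes "f \<in> nonneg_fun_space M N" "g \<in> nonneg_fun_space M N" "0 \<le> a"
  shows "(\<lambda>x. f x + ennreal a * g x) \<in> nonneg_fun_space M N"
proof -
  have [measurable]: "f \<in> borel_measurable M" "g \<in> borel_measurable M"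
    using assms by (auto simp: nonneg_fun_space_iff)
  have "qnorm (\<lambda>x. f x + ennreal a * g x) \<le> ennreal c * (qnorm f + ennreal a * qnorm g)"
    using qnorm_add[of f "\<lambda>x. ennreal a * g x"] assms(3) by (simp add: qnorm_cmult)
  also have "\<dots> < \<infinity>"
    using assms by (auto simp: nonneg_fun_space_iff ennreal_mult_less_top)
  finally show ?thesis by (simp add: nonneg_fun_space_iff)
qed

lemma upper_gradient_imp_weak:
  assumes "upper_gradient u g"
  shows "weak_upper_gradient M N u g"
proof -
  have "qnorm (\<lambda>_. 0) = 0" by (simp add: qnorm_eq_0)
  then have "almost_every_curve N (\<lambda>\<gamma>. line_measurable \<gamma> g \<and> end_gap u \<gamma> \<le> line_integral \<gamma> g)"
    using assms
    by (intro almost_every_curveI[of "\<lambda>_. 0"]) (auto simp: upper_gradient_def line_measurable_borel)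
  then show ?thesis
    using assms by (auto simp: weak_upper_gradient_def upper_gradient_def borel_measurable_imp_measurable)
qed

text \<open>
  \<open>g'\<close> is a Borel majorant of \<open>g\<close>. On a curve where \<open>\<integral> \<rho> ds\<close> is finite, \<open>g\<close> and hence \<open>g'\<close> already bounds the
  oscillation; on all others the additional term \<open>a \<rho>\<close> makes the right-hand side infinite.
\<close>

lemma weak_upper_gradient_approx:
  assumes "weak_upper_gradient M N u g" "g \<in> nonneg_fun_space M N"
  obtains g' \<rho> where "g' \<in> nonneg_fun_space M N" "\<rho> \<in> nonneg_fun_space M N"
    "AE x in M. g' x = g x" "\<And>a. 0 < a \<Longrightarrow> upper_gradient u (\<lambda>x. g' x + ennreal a * \<rho> x)"
proof -
  have g: "g \<in> borel_measurable M" using assms by (simp add: nonneg_fun_space_iff)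
  from borel_majorant[OF g] obtain g' where g' [measurable]: "g' \<in> borel_measurable borel"
    and le: "\<And>x. g x \<le> g' x" and eq: "AE x in M. g' x = g x" by blast
  obtain \<rho> where \<rho> [measurable]: "\<rho> \<in> borel_measurable borel" and fin: "qnorm \<rho> < \<infinity>"
    and gap: "\<And>\<gamma>. \<gamma> \<in> curves \<Longrightarrow> line_integral \<gamma> \<rho> < \<infinity> \<Longrightarrow> end_gap u \<gamma> \<le> line_integral \<gamma> g"
  proof -
    have "almost_every_curve N (\<lambda>\<gamma>. line_measurable \<gamma> g \<and> end_gap u \<gamma> \<le> line_integral \<gamma> g)"
      using assms(1) by (simp add: weak_upper_gradient_def)
    then show thesis by (rule almost_every_curveE) (blast intro: that)
  qed
  show ?thesis
  proof
    show "g' \<in> nonneg_fun_space M N"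
      using eq by (intro nonneg_fun_space_mono[OF assms(2)])
        (auto intro: borel_measurable_imp_measurable)
    show "\<rho> \<in> nonneg_fun_space M N"
      using fin by (simp add: nonneg_fun_space_iff borel_measurable_imp_measurable)
    show "upper_gradient u (\<lambda>x. g' x + ennreal a * \<rho> x)" if "0 < a" for a
      unfolding upper_gradient_def
    proof (intro conjI ballI)
      fix \<gamma> :: "real \<times> (real \<Rightarrow> 'a)" assume \<gamma>: "\<gamma> \<in> curves"
      show "end_gap u \<gamma> \<le> line_integral \<gamma> (\<lambda>x. g' x + ennreal a * \<rho> x)"
      proof (cases "line_integral \<gamma> \<rho> < \<infinity>")
        case True
        have "g x \<le> g' x + ennreal a * \<rho> x" for x
          using le[of x] by (simp add: add_increasing2)
        then show ?thesis
          by (rule order_trans[OF gap[OF \<gamma> True] line_integral_mono])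
      next
        case False
        then have "line_integral \<gamma> (\<lambda>x. ennreal a * \<rho> x) = \<infinity>"
          using \<gamma> that by (simp add: line_integral_cmult less_top[symmetric] ennreal_mult_top)
        moreover have "line_integral \<gamma> (\<lambda>x. ennreal a * \<rho> x)
            \<le> line_integral \<gamma> (\<lambda>x. g' x + ennreal a * \<rho> x)"
          by (intro line_integral_mono) simp
        ultimately show ?thesis by (simp add: top_unique)
      qed
    qed measurable
  qed (rule eq)
qed

text \<open>
  Almost every curve meets the set where \<open>g\<close> and \<open>g'\<close> differ in a parameter set of measure zero.
\<close>

lemma weak_upper_gradient_cong_AE:
  assumes "weak_upper_gradient M N u g" "AE x in M. g' x = g x"
  shows "weak_upper_gradient M N u g'"
proof -
  have "g' \<in> borel_measurable M"
    using assms by (auto simp: weak_upper_gradient_def intro: borel_measurable_cong_AE)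
  moreover have "almost_every_curve N
      (\<lambda>\<gamma>. upper_gradient_along u g \<gamma> \<and>
        (case \<gamma> of (l, \<gamma>) \<Rightarrow> AE t in lebesgue. t \<in> {0..l} \<longrightarrow> g' (\<gamma> t) = g (\<gamma> t)))"
    using assms unfolding weak_upper_gradient_iff
    by (intro almost_every_curve_conj almost_every_curve_AE) auto
  then have "almost_every_curve N (upper_gradient_along u g')"
  proof (rule almost_every_curve_mono, clarify)
    fix l and \<gamma> :: "real \<Rightarrow> 'a"
    assume g: "upper_gradient_along u g (l, \<gamma>)"
      and eq: "AE t in lebesgue. t \<in> {0..l} \<longrightarrow> g' (\<gamma> t) = g (\<gamma> t)"
    have eq': "AE t in lebesgue. g' (\<gamma> t) * indicator {0..l} t = g (\<gamma> t) * indicator {0..l} t"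
      using eq by eventually_elim (auto simp: indicator_def)
    have "line_measurable (l, \<gamma>) g'"
      using completion.borel_measurable_cong_AE[OF _ eq'] g
      by (simp add: upper_gradient_along_def line_measurable_iff)
    then show "upper_gradient_along u g' (l, \<gamma>)"
      using g nn_integral_cong_AE[OF eq']
      by (simp add: upper_gradient_along_def line_integral_def)
  qed
  ultimately show ?thesis by (simp add: weak_upper_gradient_iff)
qed

text \<open>
  On almost every curve both integrals are finite and all subcurves satisfy the bounds with \<open>g\<close> and with \<open>h\<close>,
  so that the bounds can be spliced there. Finiteness serves the dominated convergence in the splicing.
\<close>

lemma weak_upper_gradient_min:
  assumes "weak_upper_gradient M N u g" "g \<in> nonneg_fun_space M N"
    and "weak_upper_gradient M N u h" "h \<in> nonneg_fun_space M N"
  shows "weak_upper_gradient M N u (\<lambda>x. min (g x) (h x))"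
proof -
  have "almost_every_curve N (\<lambda>\<gamma>.
      (case \<gamma> of (l, \<gamma>) \<Rightarrow> \<forall>a b. 0 \<le> a \<longrightarrow> a < b \<longrightarrow> b \<le> l \<longrightarrow>
        upper_gradient_along u g (subcurve a b (l, \<gamma>)) \<and> upper_gradient_along u h (subcurve a b (l, \<gamma>))) \<and>
      line_integral \<gamma> g < \<infinity> \<and> line_integral \<gamma> h < \<infinity>)"
    using assms unfolding weak_upper_gradient_iff
    by (intro almost_every_curve_conj almost_every_curve_subcurves
        almost_every_curve_finite_integral) auto
  then have "almost_every_curve N (upper_gradient_along u (\<lambda>x. min (g x) (h x)))"
  proof (rule almost_every_curve_mono, clarify)
    fix l and \<gamma> :: "real \<Rightarrow> 'a"
    assume \<gamma>: "(l, \<gamma>) \<in> curves"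
      and P: "\<forall>a b. 0 \<le> a \<longrightarrow> a < b \<longrightarrow> b \<le> l \<longrightarrow>
        upper_gradient_along u g (subcurve a b (l, \<gamma>)) \<and> upper_gradient_along u h (subcurve a b (l, \<gamma>))"
      and fin: "line_integral (l, \<gamma>) g < \<infinity>" "line_integral (l, \<gamma>) h < \<infinity>"
    have "0 < l" using \<gamma> by (simp add: curves_def)
    then have "upper_gradient_along u g (l, \<gamma>)" "upper_gradient_along u h (l, \<gamma>)"
      using P[rule_format, of 0 l] by auto
    then show "upper_gradient_along u (\<lambda>x. min (g x) (h x)) (l, \<gamma>)"
      using P fin by (auto simp: upper_gradient_along_def intro!: line_measurable_min end_gap_le_line_integral_min[OF \<gamma>])
  qed
  moreover have "(\<lambda>x. min (g x) (h x)) \<in> borel_measurable M"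
    using assms by (intro borel_measurable_min) (simp_all add: weak_upper_gradient_iff)
  ultimately show ?thesis
    by (simp add: weak_upper_gradient_iff)
qed

text \<open>
  The integral of \<open>g 0\<close> is finite on almost every curve, which permits monotone convergence from above
  for the line integrals.
\<close>

lemma weak_upper_gradient_INF:
  assumes dec: "decseq g"
    and g: "\<And>n. weak_upper_gradient M N u (g n)" and g0: "g 0 \<in> nonneg_fun_space M N"
  shows "weak_upper_gradient M N u (\<lambda>x. INF n. g n x)"
proof -
  have "almost_every_curve N (\<lambda>\<gamma>. (\<forall>n. upper_gradient_along u (g n) \<gamma>) \<and> line_integral \<gamma> (g 0) < \<infinity>)"
    using g g0 unfolding weak_upper_gradient_iff
    by (intro almost_every_curve_conj almost_every_curve_countable almost_every_curve_finite_integral) auto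
  then have "almost_every_curve N (upper_gradient_along u (\<lambda>x. INF n. g n x))"
  proof (rule almost_every_curve_mono, clarify)
    fix l and \<gamma> :: "real \<Rightarrow> 'a"
    assume P: "\<forall>n. upper_gradient_along u (g n) (l, \<gamma>)"
      and fin: "line_integral (l, \<gamma>) (g 0) < \<infinity>"
    define f where "f n t = g n (\<gamma> t) * indicator {0..l} t" for n t
    have [measurable]: "f n \<in> borel_measurable lebesgue" for n
      using P by (simp add: upper_gradient_along_def line_measurable_iff f_def[abs_def])
    have INF: "(INF n. g n (\<gamma> t)) * indicator {0..l} t = (INF n. f n t)" for t
      by (cases "t \<in> {0..l}") (simp_all add: f_def)
    have "decseq f"
      using decseq_SucD[OF dec]
      by (intro decseq_SucI) (auto simp: le_fun_def f_def intro!: mult_right_mono)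
    then have "(\<integral>\<^sup>+t. (INF n. f n t) \<partial>lebesgue) = (INF n. \<integral>\<^sup>+t. f n t \<partial>lebesgue)"
    proof (rule nn_integral_monotone_convergence_INF_decseq)
      show "(\<integral>\<^sup>+t. f 0 t \<partial>lebesgue) < \<infinity>"
        using fin by (simp add: line_integral_def f_def)
    qed simp
    also have "end_gap u (l, \<gamma>) \<le> \<dots>"
      using P by (intro INF_greatest) (auto simp: upper_gradient_along_def line_integral_def f_def)
    finally have "end_gap u (l, \<gamma>) \<le> line_integral (l, \<gamma>) (\<lambda>x. INF n. g n x)"
      by (simp add: line_integral_def INF)
    moreover have "line_measurable (l, \<gamma>) (\<lambda>x. INF n. g n x)"
      unfolding line_measurable_iff INF by measurable
    ultimately show "upper_gradient_along u (\<lambda>x. INF n. g n x) (l, \<gamma>)"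
      by (simp add: upper_gradient_along_def)
  qed
  moreover have "(\<lambda>x. INF n. g n x) \<in> borel_measurable M"
    using g by (intro borel_measurable_INF) (simp_all add: weak_upper_gradient_iff)
  ultimately show ?thesis by (simp add: weak_upper_gradient_iff)
qed

section \<open>Existence of a minimal weak upper gradient\<close>

text \<open>
  An essential infimum of the weak upper gradients in \<open>X\<close>. To compare them by numbers, the functional
  \<open>J g = \<integral> w / (1 + g) d\<mu>\<close> with a positive integrable weight \<open>w\<close> is maximized: it is finite and strictly
  decreasing in \<open>g\<close> modulo null sets. A maximizing sequence can be made decreasing by taking minima, and its limit \<open>G\<close>
  is again a weak upper gradient. For any other \<open>f\<close>, the minimum of \<open>G\<close> and \<open>f\<close> is a competitor, so that
  maximality forces it to be \<open>G\<close> almost everywhere.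
\<close>

lemma ex_minimal_weak_upper_gradient:
  assumes ne: "h0 \<in> nonneg_fun_space M N" "weak_upper_gradient M N u h0"
  shows "\<exists>g. minimal_weak_upper_gradient M N u g"
proof -
  define W where "W = {g \<in> nonneg_fun_space M N. weak_upper_gradient M N u g}"
  have meas: "g \<in> borel_measurable M" if "g \<in> W" for g
    using that by (simp add: W_def weak_upper_gradient_def)
  obtain w :: "'a \<Rightarrow> ennreal" where w [measurable]: "w \<in> borel_measurable M"
    and w_int: "integral\<^sup>N M w \<noteq> \<infinity>" and w_pos: "\<And>x. 0 < w x" "\<And>x. w x < \<infinity>"
    using Ex_finite_integrable_function by (auto simp: space_M)
  define J where "J g = (\<integral>\<^sup>+x. inverse (1 + g x) * w x \<partial>M)" for g
  have J_anti: "J h \<le> J g" if "\<And>x. g x \<le> h x" for g h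
    unfolding J_def using that
    by (intro nn_integral_mono mult_right_mono inverse_le_inverse_ennreal add_left_mono) auto
  have J_fin: "J g < \<infinity>" for g
  proof -
    have "inverse (1 + g x) \<le> 1" for x
      using inverse_le_inverse_ennreal[of 1 "1 + g x"] by simp
    then have "J g \<le> integral\<^sup>N M w"
      unfolding J_def by (intro nn_integral_mono) (metis mult_1 mult_right_mono zero_le)
    then show ?thesis using w_int by (auto simp: less_top[symmetric] top_unique)
  qed
  have "W \<noteq> {}" using ne by (auto simp: W_def)
  then obtain F :: "nat \<Rightarrow> ennreal" where F: "range F \<subseteq> J ` W" "(SUP g\<in>W. J g) = (SUP n. F n)"
    using ennreal_SUP_countable_SUP[of W J] by auto
  then have "\<forall>n. \<exists>h. h \<in> W \<and> F n = J h" by blast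
  then obtain h where h: "\<forall>n. h n \<in> W \<and> F n = J (h n)" by (rule choice[THEN exE])
  define g where "g = rec_nat (h 0) (\<lambda>n g x. min (g x) (h (Suc n) x))"
  have g_simps: "g 0 = h 0" "g (Suc n) = (\<lambda>x. min (g n x) (h (Suc n) x))" for n
    by (simp_all add: g_def)
  have min_W: "(\<lambda>x. min (f1 x) (f2 x)) \<in> W" if "f1 \<in> W" "f2 \<in> W" for f1 f2
  proof -
    have "(\<lambda>x. min (f1 x) (f2 x)) \<in> nonneg_fun_space M N"
      by (rule nonneg_fun_space_mono[of f1]) (use that meas in \<open>auto simp: W_def\<close>)
    then show ?thesis using that weak_upper_gradient_min by (simp add: W_def)
  qed
  have g_W: "g n \<in> W" for n
    by (induction n) (use h min_W in \<open>auto simp: g_simps\<close>)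
  have g_le: "g n x \<le> h n x" for n x
    by (cases n) (auto simp: g_simps)
  have dec: "decseq g"
    by (intro decseq_SucI) (auto simp: g_simps le_fun_def)
  define G where "G x = (INF n. g n x)" for x
  have G_le: "G x \<le> h n x" for n x
    unfolding G_def by (rule INF_lower2[of n]) (use g_le in auto)
  have "weak_upper_gradient M N u G"
    unfolding G_def using dec g_W by (intro weak_upper_gradient_INF) (auto simp: W_def)
  moreover from this have "G \<in> nonneg_fun_space M N"
    using nonneg_fun_space_mono[of "h 0" G] h G_le[of _ 0]
    by (simp add: W_def weak_upper_gradient_def)
  ultimately have G_W: "G \<in> W" by (simp add: W_def)
  have max: "J f \<le> J G" if "f \<in> W" for f
  proof -
    have "J f \<le> (SUP n. F n)" using that F(2) by (metis SUP_upper)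
    also have "\<dots> \<le> J G" using h G_le by (intro SUP_least) (simp add: J_anti)
    finally show ?thesis .
  qed
  have "AE x in M. G x \<le> f x" if f: "f \<in> W" for f
  proof -
    define m where "m x = min (G x) (f x)" for x
    have m: "m \<in> W" unfolding m_def using G_W f by (rule min_W)
    have [measurable]: "m \<in> borel_measurable M" "G \<in> borel_measurable M"
      using meas m G_W by auto
    have "AE x in M. inverse (1 + m x) * w x \<le> inverse (1 + G x) * w x"
    proof (rule ccontr)
      assume "\<not> ?thesis"
      then have "J G < J m"
        unfolding J_def
      proof (intro nn_integral_less)
        show "(\<integral>\<^sup>+x. inverse (1 + G x) * w x \<partial>M) \<noteq> \<infinity>"
          using J_fin[of G] by (simp add: J_def)
        show "AE x in M. inverse (1 + G x) * w x \<le> inverse (1 + m x) * w x"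
          by (intro AE_I2 mult_right_mono inverse_le_inverse_ennreal add_left_mono)
            (auto simp: m_def)
      qed measurable
      then show False using max[OF m] by simp
    qed
    then show ?thesis
    proof eventually_elim
      case (elim x)
      then have "inverse (1 + m x) \<le> inverse (1 + G x)"
        using w_pos[of x] by (simp add: mult.commute[of _ "w x"] ennreal_mult_le_mult_iff less_top)
      moreover have "inverse (1 + G x) \<le> inverse (1 + m x)"
        by (intro inverse_le_inverse_ennreal add_left_mono) (simp add: m_def)
      ultimately have "inverse (1 + m x) = inverse (1 + G x)" by (rule antisym)
      then have "1 + m x = 1 + G x" by (rule ennreal_inverse_inject)
      then have "m x = G x" by simp
      then show ?case by (simp add: m_def min_def split: if_splits)
    qed
  qed
  then have "minimal_weak_upper_gradient M N u G"
    using G_W by (auto simp: minimal_weak_upper_gradient_def W_def)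
  then show ?thesis by blast
qed

lemma minimal_weak_upper_gradient_cong_AE:
  assumes "minimal_weak_upper_gradient M N u g" "AE x in M. g' x = g x"
  shows "minimal_weak_upper_gradient M N u g'"
proof -
  have g': "weak_upper_gradient M N u g'"
    using assms by (auto simp: minimal_weak_upper_gradient_def intro: weak_upper_gradient_cong_AE)
  moreover have "g' \<in> nonneg_fun_space M N"
  proof (rule nonneg_fun_space_mono[of g])
    show "AE x in M. g' x \<le> g x" using assms(2) by eventually_elim simp
  qed (use assms g' in \<open>simp_all add: minimal_weak_upper_gradient_def weak_upper_gradient_def\<close>)
  moreover have "AE x in M. g' x \<le> h x"
    if "h \<in> nonneg_fun_space M N" "weak_upper_gradient M N u h" for h
  proof -
    have "AE x in M. g x \<le> h x" using assms that by (simp add: minimal_weak_upper_gradient_def)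
    then show ?thesis using assms(2) by eventually_elim simp
  qed
  ultimately show ?thesis by (simp add: minimal_weak_upper_gradient_def)
qed

end

section \<open>Averages transformed by a scale function\<close>

locale scale_function =
  fixes \<phi> :: "ennreal \<Rightarrow> ennreal"
  assumes cont: "continuous_on UNIV \<phi>" and strict_mono: "strict_mono \<phi>" and zero: "\<phi> 0 = 0"
begin

lemma phi_mono: "x \<le> y \<Longrightarrow> \<phi> x \<le> \<phi> y"
  using strict_mono by (simp add: strict_mono_less_eq)

lemma inv_phi [simp]: "inv \<phi> (\<phi> x) = x"
  using strict_mono by (simp add: strict_mono_imp_inj_on)

text \<open>
  The intermediate value theorem. The averages of \<open>\<phi> \<circ> f\<close> over balls lie in this range, which is where
  \<open>inv \<phi>\<close> is meaningful.
\<close>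

lemma range_phi: "range \<phi> = {..\<phi> top}"
proof -
  have "y \<in> range \<phi>" if "y \<le> \<phi> top" for y
    using IVT'[of \<phi> 0 y top] continuous_on_subset[OF cont] that zero by auto
  then show ?thesis using phi_mono by auto
qed

lemma inv_phi_mono:
  assumes "x \<le> y" "y \<le> \<phi> top"
  shows "inv \<phi> x \<le> inv \<phi> y"
proof -
  have "x \<in> range \<phi>" "y \<in> range \<phi>" using assms by (auto simp: range_phi)
  then obtain a b where "x = \<phi> a" "y = \<phi> b" by blast
  then show ?thesis using assms strict_mono by (simp add: strict_mono_less_eq)
qed

text \<open>
  A continuous injection of the compact space \<open>[0,\<infinity>]\<close> is a homeomorphism onto its image.
\<close>

lemma continuous_on_inv_phi: "continuous_on (range \<phi>) (inv \<phi>)"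
  by (rule continuous_on_inv[OF cont compact_UNIV]) simp

end

lemma nn_average_le:
  assumes "\<And>x. f x \<le> b" "A \<in> sets M" "0 < emeasure M A"
  shows "nn_average M A f \<le> b"
proof (cases "emeasure M A = \<infinity>")
  case False
  have "(\<integral>\<^sup>+x\<in>A. f x \<partial>M) \<le> (\<integral>\<^sup>+x. b * indicator A x \<partial>M)"
    using assms by (intro nn_integral_mono mult_right_mono) auto
  also have "\<dots> = emeasure M A * b" using assms by (simp add: nn_integral_cmult_indicator mult.commute)
  finally show ?thesis
    unfolding nn_average_def using assms by (intro divide_le_posI_ennreal)
qed (simp add: nn_average_def ennreal_divide_top)

lemma nn_average_mono_AE:
  assumes "AE x in M. f x \<le> g x"
  shows "nn_average M A f \<le> nn_average M A g"
proof -
  have "AE x in M. f x * indicator A x \<le> g x * indicator A x"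
    using assms by eventually_elim (rule mult_right_mono, auto)
  then show ?thesis
    unfolding nn_average_def by (intro divide_right_mono_ennreal nn_integral_mono_AE)
qed

section \<open>Lebesgue points of averages\<close>

context function_lattice_on_space
begin

lemma ball_sets: "ball x r \<in> sets M"
  using borel_sets by auto

text \<open>
  Passes from averages in \<^typ>\<open>real\<close> to averages in \<^typ>\<open>ennreal\<close>: over balls small enough for \<open>h\<close> to be
  integrable on them the two agree.
\<close>

lemma nn_average_tendsto:
  assumes diff: "lebesgue_differentiation M"
    and loc: "(\<lambda>x. enn2ereal (h x)) \<in> locally_integrable M"
  shows "AE x in M. ((\<lambda>r. nn_average M (ball x r) h) \<longlongrightarrow> h x) (at_right 0)"
proof -
  have [measurable]: "h \<in> borel_measurable M"
    using loc measurable_compose[OF _ measurable_e2ennreal, of "\<lambda>x. enn2ereal (h x)" M]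
    by (simp add: locally_integrable_def)
  have avg: "e2ennreal (ereal ((LINT y:ball x r|M. real_of_ereal (enn2ereal (h y))) / measure M (ball x r)))
      = nn_average M (ball x r) h"
    if r: "0 < r" and fin: "(\<integral>\<^sup>+y\<in>ball x r. h y \<partial>M) < \<infinity>" for x r
  proof -
    note [measurable] = ball_sets
    let ?I = "\<integral>\<^sup>+y\<in>ball x r. h y \<partial>M"
    have "AE y in M. h y * indicator (ball x r) y \<noteq> \<infinity>"
      using fin by (intro nn_integral_noteq_infinite) auto
    then have "AE y in M. ennreal (indicator (ball x r) y *\<^sub>R enn2real (h y)) = h y * indicator (ball x r) y"
      by eventually_elim (auto simp: indicator_def less_top)
    then have "(\<integral>\<^sup>+y. ennreal (indicator (ball x r) y *\<^sub>R enn2real (h y)) \<partial>M) = ?I"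
      by (rule nn_integral_cong_AE)
    then have "(LINT y:ball x r|M. real_of_ereal (enn2ereal (h y))) = enn2real ?I"
      unfolding set_lebesgue_integral_def real_of_ereal_enn2ereal
      by (subst integral_eq_nn_integral) auto
    moreover have "emeasure M (ball x r) = ennreal (measure M (ball x r))"
      using ball_finite[OF r, of x] by (simp add: emeasure_eq_ennreal_measure less_top)
    moreover have "0 < measure M (ball x r)"
      using calculation(2) ball_pos[OF r, of x] by simp
    moreover obtain i where "?I = ennreal i" "0 \<le> i" using fin by (cases ?I) auto
    ultimately show ?thesis
      by (simp add: nn_average_def divide_ennreal)
  qed
  have "AE x in M. ((\<lambda>r. ereal ((LINT y:ball x r|M. real_of_ereal (enn2ereal (h y)))
      / measure M (ball x r))) \<longlongrightarrow> enn2ereal (h x)) (at_right 0)"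
    using diff loc by (auto simp: lebesgue_differentiation_def)
  then show ?thesis
  proof eventually_elim
    case (elim x)
    obtain R where R: "0 < R" "(\<integral>\<^sup>+y\<in>ball x R. h y \<partial>M) < \<infinity>"
      using loc by (auto simp: locally_integrable_def)
    have "eventually (\<lambda>r. 0 < r \<and> r < R) (at_right 0)"
      using R(1) by (auto simp: eventually_at_right[of 0 R] intro!: exI[of _ R])
    then have ev: "eventually (\<lambda>r. e2ennreal (ereal ((LINT y:ball x r|M. real_of_ereal (enn2ereal (h y)))
        / measure M (ball x r))) = nn_average M (ball x r) h) (at_right 0)"
    proof eventually_elim
      case (elim r)
      have "(\<integral>\<^sup>+y\<in>ball x r. h y \<partial>M) \<le> (\<integral>\<^sup>+y\<in>ball x R. h y \<partial>M)"
        using elim by (intro nn_integral_mono) (auto simp: indicator_def)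
      then show ?case using R elim by (intro avg) (auto intro: le_less_trans)
    qed
    from tendsto_e2ennrealI[OF elim] ev show ?case
      by (auto elim: Lim_transform_eventually)
  qed
qed

end

section \<open>Upper densities of weak upper gradients\<close>

locale phi_density_setting =
  function_lattice_on_space M N c + scale_function \<phi>
  for M :: "'a::metric_space measure" and N c and \<phi> +
  assumes differentiation: "lebesgue_differentiation M"
    and phi_locally_integrable: "f \<in> fun_space M N \<Longrightarrow>
      (\<lambda>x. enn2ereal (\<phi> (e2ennreal \<bar>f x\<bar>))) \<in> locally_integrable M"
begin

lemma nn_average_ball_le_phi_top:
  "0 < r \<Longrightarrow> nn_average M (ball x r) (\<lambda>x. \<phi> (f x)) \<le> \<phi> top"
  by (intro nn_average_le phi_mono ball_sets ball_pos) auto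

text \<open>
  An inequality that holds almost everywhere becomes one that holds at every point, since null sets
  do not affect the averages.
\<close>

lemma upper_phi_density_mono:
  assumes "AE x in M. f x \<le> g x"
  shows "upper_phi_density M \<phi> f x \<le> upper_phi_density M \<phi> g x"
  unfolding upper_phi_density_def
proof (rule Limsup_mono)
  have le: "AE x in M. \<phi> (f x) \<le> \<phi> (g x)"
    using assms by eventually_elim (rule phi_mono)
  have "eventually (\<lambda>r::real. 0 < r) (at_right 0)" by (rule eventually_at_right_less)
  then show "eventually (\<lambda>r. phi_mean M \<phi> (ball x r) f \<le> phi_mean M \<phi> (ball x r) g) (at_right 0)"
    by eventually_elim
      (auto simp: phi_mean_def intro!: inv_phi_mono nn_average_mono_AE[OF le] nn_average_ball_le_phi_top)
qed

lemma upper_phi_density_eq: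
  assumes "g \<in> nonneg_fun_space M N"
  shows "AE x in M. upper_phi_density M \<phi> g x = g x"
proof -
  have "(\<lambda>x. enn2ereal (\<phi> (g x))) \<in> locally_integrable M"
    using phi_locally_integrable[of "\<lambda>x. enn2ereal (g x)"] assms by (simp add: nonneg_fun_space_def)
  from nn_average_tendsto[OF differentiation this] show ?thesis
  proof eventually_elim
    case (elim x)
    have pos: "eventually (\<lambda>r::real. 0 < r) (at_right 0)" by (rule eventually_at_right_less)
    have "((\<lambda>r. inv \<phi> (nn_average M (ball x r) (\<lambda>y. \<phi> (g y)))) \<longlongrightarrow> inv \<phi> (\<phi> (g x))) (at_right 0)"
    proof (rule continuous_on_tendsto_compose[OF continuous_on_inv_phi elim])
      show "eventually (\<lambda>r. nn_average M (ball x r) (\<lambda>y. \<phi> (g y)) \<in> range \<phi>) (at_right 0)"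
        using pos by eventually_elim (simp add: range_phi nn_average_ball_le_phi_top)
    qed simp
    then show ?case
      by (simp add: upper_phi_density_def phi_mean_def lim_imp_Limsup)
  qed
qed

lemma g1_g2_eq_minimal:
  assumes "minimal_weak_upper_gradient M N u g"
  shows "AE x in M. g1_fun M N \<phi> u x = g x \<and> g2_fun M N \<phi> u x = g x"
proof -
  have g: "weak_upper_gradient M N u g" "g \<in> nonneg_fun_space M N"
    and min: "\<And>h. h \<in> nonneg_fun_space M N \<Longrightarrow> weak_upper_gradient M N u h \<Longrightarrow> AE x in M. g x \<le> h x"
    using assms by (auto simp: minimal_weak_upper_gradient_def)
  \<comment> \<open>Pointwise everywhere: no null set depending on the competitor occurs here.\<close>
  have lower: "upper_phi_density M \<phi> g x \<le> g1_fun M N \<phi> u x" for x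
    unfolding g1_fun_def using min by (intro INF_greatest upper_phi_density_mono) auto
  have g1_le_g2: "g1_fun M N \<phi> u x \<le> g2_fun M N \<phi> u x" for x
    unfolding g1_fun_def g2_fun_def
    by (intro INF_superset_mono) (auto intro: upper_gradient_imp_weak)
  obtain g' \<rho> where g': "g' \<in> nonneg_fun_space M N" and \<rho>: "\<rho> \<in> nonneg_fun_space M N"
    and eq: "AE x in M. g' x = g x"
    and ug: "\<And>a. 0 < a \<Longrightarrow> upper_gradient u (\<lambda>x. g' x + ennreal a * \<rho> x)"
    using weak_upper_gradient_approx[OF g] by blast
  define e where "e k = inverse (real (Suc k))" for k
  have e: "0 < e k" for k by (simp add: e_def)
  have space: "(\<lambda>x. g' x + ennreal (e k) * \<rho> x) \<in> nonneg_fun_space M N" for k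
    using nonneg_fun_space_add_cmult[OF g' \<rho>] e[of k] by simp
  have "AE x in M. \<forall>k. upper_phi_density M \<phi> (\<lambda>x. g' x + ennreal (e k) * \<rho> x) x
      = g' x + ennreal (e k) * \<rho> x"
    using upper_phi_density_eq[OF space] by (simp add: AE_all_countable)
  moreover have "AE x in M. \<rho> x < \<infinity>"
    using finite_AE \<rho> by (simp add: nonneg_fun_space_iff)
  ultimately have "AE x in M. g2_fun M N \<phi> u x \<le> g x"
    using eq
  proof eventually_elim
    case (elim x)
    have "g2_fun M N \<phi> u x \<le> g x + ennreal (e k) * \<rho> x" for k
      unfolding g2_fun_def
      by (rule INF_lower2[of "\<lambda>x. g' x + ennreal (e k) * \<rho> x"])
        (use space ug[OF e] elim in auto)
    moreover have "(\<lambda>k. g x + ennreal (e k) * \<rho> x) \<longlonglongrightarrow> g x + 0 * \<rho> x"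
    proof -
      obtain r where r: "0 \<le> r" "\<rho> x = ennreal r" using elim by (cases "\<rho> x") auto
      have "(\<lambda>k. e k * r) \<longlonglongrightarrow> 0 * r"
        unfolding e_def by (intro tendsto_mult_right LIMSEQ_inverse_real_of_nat)
      then have "(\<lambda>k. g x + ennreal (e k * r)) \<longlonglongrightarrow> g x + ennreal (0 * r)"
        by (intro tendsto_add tendsto_ennrealI) auto
      then show ?thesis using r e by (simp add: ennreal_mult less_imp_le)
    qed
    ultimately show ?case
      using LIMSEQ_le_const by fastforce
  qed
  with upper_phi_density_eq[OF g(2)] show ?thesis
  proof eventually_elim
    case (elim x)
    with lower[of x] g1_le_g2[of x] show ?case by (auto intro: antisym order_trans)
  qed
qed

end

theorem theorem4p10:
  fixes M :: "'a::metric_space measure"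
    and N :: "('a \<Rightarrow> ereal) \<Rightarrow> ennreal"
    and c :: real
    and \<phi> :: "ennreal \<Rightarrow> ennreal"
    and u :: "'a \<Rightarrow> ereal"
  assumes "borel_regular_space M"
    and "quasi_banach_function_lattice M N c"
    and "lebesgue_differentiation M"
    and "continuous_on UNIV \<phi>" and "strict_mono \<phi>" and "\<phi> 0 = 0"
    and "\<And>f. f \<in> fun_space M N \<Longrightarrow>
           (\<lambda>x. enn2ereal (\<phi> (e2ennreal \<bar>f x\<bar>))) \<in> locally_integrable M"
    and "phi_subadditive \<phi> \<or> minkowski_type M \<phi>"
    and "u \<in> dirichlet_space M N"
  shows "(\<forall>g\<^sub>u. minimal_weak_upper_gradient M N u g\<^sub>u \<longrightarrow>
            (AE x in M. g1_fun M N \<phi> u x = g\<^sub>u x \<and> g2_fun M N \<phi> u x = g\<^sub>u x)) \<and>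
         minimal_weak_upper_gradient M N u (g1_fun M N \<phi> u) \<and>
         minimal_weak_upper_gradient M N u (g2_fun M N \<phi> u)"
proof -
  interpret phi_density_setting M N c \<phi>
    using assms
    by (intro phi_density_setting.intro function_lattice_on_space.intro scale_function.intro
        phi_density_setting_axioms.intro)
  obtain h where "h \<in> nonneg_fun_space M N" "upper_gradient u h"
    using assms(9) by (auto simp: dirichlet_space_def)
  then obtain g where g: "minimal_weak_upper_gradient M N u g"
    using ex_minimal_weak_upper_gradient upper_gradient_imp_weak by blast
  have eq: "AE x in M. g1_fun M N \<phi> u x = g x \<and> g2_fun M N \<phi> u x = g x"
    using g by (rule g1_g2_eq_minimal)
  then have "AE x in M. g1_fun M N \<phi> u x = g x" "AE x in M. g2_fun M N \<phi> u x = g x"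
    by auto
  with g show ?thesis
    using g1_g2_eq_minimal minimal_weak_upper_gradient_cong_AE by blast
qed

end
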